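(* Let $X$ be a set. Under the equivalence $[\mathcal{UF}_{\mathbf{Set}^X},\mathbf{Set}]\simeq\mathsf{FC}(\mathbf{Set}^X,\mathbf{Set})$, the representable functor at $(A\in\mathbf{Set}^X,\ \mathcal U\in\beta(X.A))$ corresponds to the composite $$\mathbf{Set}^X\xrightarrow{\ \mathbf{Set}^{\pi_A}\ }\mathbf{Set}^{X.A}\xrightarrow{\ \Pi_{\mathcal U}\ }\mathbf{Set}.$$ In particular, the representable functor at $(1,\mathcal U)$ corresponds to $\Pi_{\mathcal U}\colon\mathbf{Set}^X\to\mathbf{Set}$.
   Context: For an $X$-indexed family of sets $A\in\mathbf{Set}^X$, write $X.A=\{(x,a):x\in X,a\in A(x)\}$ and $\pi_A\colon X.A\to X$ for the first projection; $\mathbf{Set}^{\pi_A}$ is reindexing along $\pi_A$, $Y\mapsto (Y(\pi_A(t))\mid t\in X.A)$. $1\in\mathbf{Set}^X$ is the terminal family, for which $X.1\cong X$. For an ultrafilter $\mathcal U$ on a set $S$ and an $S$-indexed family $Y$, the ultraproduct $\Pi_{\mathcal U}(Y)$ is the set of equivalence classes of partial sections of $\pi_Y\colon S.Y\to S$ defined on a set in $\mathcal U$, where two are identified if they agree (are both defined and equal) on a set in $\mathcal U$; equivalently $\operatorname{colim}_{U\in\mathcal U}\prod_{s\in U}Y(s)$. This gives a functor $\Pi_{\mathcal U}\colon\mathbf{Set}^S\to\mathbf{Set}$. A category $\mathcal C$ with finite coproducts is extensive if each functor $+\colon\mathcal C/A\times\mathcal C/B\to\mathcal C/(A+B)$ is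 an equivalence; $\mathbf{Set}^X$ is extensive. For extensive $\mathcal C$, $\mathrm{Sum}_{\mathcal C}(C)$ is the Boolean algebra of isomorphism classes of coproduct coprojections into $C$, with homomorphisms $f^{-1}\colon\mathrm{Sum}_{\mathcal C}(D)\to\mathrm{Sum}_{\mathcal C}(C)$ given by pullback along $f\colon C\to D$. An ultrafilter on $C\in\mathcal C$ is an ultrafilter of $\mathrm{Sum}_{\mathcal C}(C)$; $\beta C$ is the set of these; $f_!(\mathcal U)=\{V:f^{-1}(V)\in\mathcal U\}$. For $\mathcal C=\mathbf{Set}^X$, the equivalence $\mathbf{Set}^X\simeq\mathbf{Set}/X$ gives $\mathrm{Sum}_{\mathbf{Set}^X}(A)\cong\mathcal P(X.A)$, so ultrafilters on the object $A\in\mathbf{Set}^X$ are identified with ultrafilters on the set $X.A$. $\mathcal{UF}_{\mathcal C}$ has as objects pairs $(C,\mathcal U)$ with $C\in\mathcal C$, $\mathcal U\in\beta C$. A map $f\colon U\to D$ defined on the domain of some $U\rightarrowtail C$ in $\mathcal U$ is continuous $(C,\mathcal U)\rightharpoonup(D,\mathcal V)$ if for all $V\in\mathrm{Sum}_{\mathcal C}(D)$: $V\in\mathcal V$ iff the composite $f^{-1}(V)\rightarrowtail U\rightarrowtail C$ is in $\mathcal U$. Two such partial maps are $=_{\mathcal U}$-equivalent if they coincide when restricted to some $W\in\mathcal U$ contained in both domains. Morphisms are $=_{\mathcal U}$-equivalence classes $[f]$ of partial continuous maps. $\mathsf{FC}(\mathcal C,\mathbf{Set})$ is the category of finite-coproduct-preserving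 functors $\mathcal C\to\mathbf{Set}$. The equivalence $[\mathcal{UF}_{\mathcal C},\mathbf{Set}]\simeq\mathsf{FC}(\mathcal C,\mathbf{Set})$ sends $B$ to $\int B$ with $(\int B)D=\sum_{\mathcal V\in\beta D}B(D,\mathcal V)$ and $(\int B)f\colon(\mathcal V,a)\mapsto(f_!(\mathcal V),B([f])(a))$. *)

theory Defs
  imports "HOL-Library.FuncSet" "HOL-Library.Infinite_Typeclass"
begin

section \<open>Categories and functors\<close>

text \<open>\<open>Comp C g f\<close> is \<open>g\<close> after \<open>f\<close>. A functor into sets is a \<open>func\<close> whose object part has
  type \<open>'o \<Rightarrow> 'v set\<close> and whose arrow part has type \<open>'m \<Rightarrow> 'v \<Rightarrow> 'v\<close>; only the values of a function
  on the set at its source matter.\<close>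

record ('o, 'm) cat =
  Obj :: "'o set"
  Arr :: "'m set"
  Dom :: "'m \<Rightarrow> 'o"
  Cod :: "'m \<Rightarrow> 'o"
  Ident :: "'o \<Rightarrow> 'm"
  Comp :: "'m \<Rightarrow> 'm \<Rightarrow> 'm"

record ('o, 'm, 'p, 'n) func =
  On_obj :: "'o \<Rightarrow> 'p"
  On_arr :: "'m \<Rightarrow> 'n"

type_synonym ('o, 'm, 'v) set_functor = "('o, 'm, 'v set, 'v \<Rightarrow> 'v) func"

definition functor_comp ::
  "('p, 'n, 'q, 'k) func \<Rightarrow> ('o, 'm, 'p, 'n) func \<Rightarrow> ('o, 'm, 'q, 'k) func"
  where "functor_comp G F = \<lparr>On_obj = On_obj G \<circ> On_obj F, On_arr = On_arr G \<circ> On_arr F\<rparr>"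

definition is_set_functor :: "('o, 'm) cat \<Rightarrow> ('o, 'm, 'v) set_functor \<Rightarrow> bool" where
  "is_set_functor C F \<longleftrightarrow>
     (\<forall>f\<in>Arr C. On_arr F f \<in> On_obj F (Dom C f) \<rightarrow> On_obj F (Cod C f)) \<and>
     (\<forall>c\<in>Obj C. \<forall>t\<in>On_obj F c. On_arr F (Ident C c) t = t) \<and>
     (\<forall>f\<in>Arr C. \<forall>g\<in>Arr C. Cod C f = Dom C g \<longrightarrow>
        (\<forall>t\<in>On_obj F (Dom C f). On_arr F (Comp C g f) t = On_arr F g (On_arr F f t)))"

definition natural_iso ::
  "('o, 'm) cat \<Rightarrow> ('o, 'm, 'v) set_functor \<Rightarrow> ('o, 'm, 'w) set_functor \<Rightarrow> ('o \<Rightarrow> 'v \<Rightarrow> 'w) \<Rightarrow> bool"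
  where "natural_iso C F G \<eta> \<longleftrightarrow>
     (\<forall>c\<in>Obj C. bij_betw (\<eta> c) (On_obj F c) (On_obj G c)) \<and>
     (\<forall>f\<in>Arr C. \<forall>t\<in>On_obj F (Dom C f).
        \<eta> (Cod C f) (On_arr F f t) = On_arr G f (\<eta> (Dom C f) t))"

definition representable :: "('o, 'm) cat \<Rightarrow> 'o \<Rightarrow> ('o, 'm, 'm) set_functor" where
  "representable C c =
     \<lparr>On_obj = (\<lambda>d. {m \<in> Arr C. Dom C m = c \<and> Cod C m = d}), On_arr = (\<lambda>n m. Comp C n m)\<rparr>"

definition is_iso :: "('o, 'm) cat \<Rightarrow> 'm \<Rightarrow> bool" where
  "is_iso C k \<longleftrightarrow> k \<in> Arr C \<and>
     (\<exists>l\<in>Arr C. Dom C l = Cod C k \<and> Cod C l = Dom C k \<and>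
        Comp C l k = Ident C (Dom C k) \<and> Comp C k l = Ident C (Cod C k))"

definition is_initial :: "('o, 'm) cat \<Rightarrow> 'o \<Rightarrow> bool" where
  "is_initial C z \<longleftrightarrow> z \<in> Obj C \<and> (\<forall>c\<in>Obj C. \<exists>!f. f \<in> Arr C \<and> Dom C f = z \<and> Cod C f = c)"

definition is_terminal :: "('o, 'm) cat \<Rightarrow> 'o \<Rightarrow> bool" where
  "is_terminal C t \<longleftrightarrow> t \<in> Obj C \<and> (\<forall>c\<in>Obj C. \<exists>!f. f \<in> Arr C \<and> Dom C f = c \<and> Cod C f = t)"

definition is_coproduct :: "('o, 'm) cat \<Rightarrow> 'm \<Rightarrow> 'm \<Rightarrow> bool" where
  "is_coproduct C i j \<longleftrightarrow> i \<in> Arr C \<and> j \<in> Arr C \<and> Cod C i = Cod C j \<and>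
     (\<forall>f\<in>Arr C. \<forall>g\<in>Arr C. Dom C f = Dom C i \<and> Dom C g = Dom C j \<and> Cod C f = Cod C g \<longrightarrow>
        (\<exists>!h. h \<in> Arr C \<and> Dom C h = Cod C i \<and> Cod C h = Cod C f \<and>
              Comp C h i = f \<and> Comp C h j = g))"

text \<open>\<open>is_pullback C f v p q\<close>: the square \<open>f \<circ> p = v \<circ> q\<close> is a pullback, so that \<open>p\<close> is
  the pullback of \<open>v\<close> along \<open>f\<close>.\<close>

definition is_pullback :: "('o, 'm) cat \<Rightarrow> 'm \<Rightarrow> 'm \<Rightarrow> 'm \<Rightarrow> 'm \<Rightarrow> bool" where
  "is_pullback C f v p q \<longleftrightarrow> f \<in> Arr C \<and> v \<in> Arr C \<and> p \<in> Arr C \<and> q \<in> Arr C \<and>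
     Cod C f = Cod C v \<and> Dom C p = Dom C q \<and> Cod C p = Dom C f \<and> Cod C q = Dom C v \<and>
     Comp C f p = Comp C v q \<and>
     (\<forall>s\<in>Arr C. \<forall>t\<in>Arr C. Dom C s = Dom C t \<and> Cod C s = Dom C f \<and> Cod C t = Dom C v \<and>
          Comp C f s = Comp C v t \<longrightarrow>
        (\<exists>!h. h \<in> Arr C \<and> Dom C h = Dom C s \<and> Cod C h = Dom C p \<and>
              Comp C p h = s \<and> Comp C q h = t))"


section \<open>Finite-coproduct-preserving functors\<close>

definition preserves_finite_coproducts :: "('o, 'm) cat \<Rightarrow> ('o, 'm, 'v) set_functor \<Rightarrow> bool" where
  "preserves_finite_coproducts C F \<longleftrightarrow>
     (\<forall>z. is_initial C z \<longrightarrow> On_obj F z = {}) \<and>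
     (\<forall>i j. is_coproduct C i j \<longrightarrow>
        bij_betw (case_sum (On_arr F i) (On_arr F j))
          (On_obj F (Dom C i) <+> On_obj F (Dom C j)) (On_obj F (Cod C i)))"

definition FC_object :: "('o, 'm) cat \<Rightarrow> ('o, 'm, 'v) set_functor \<Rightarrow> bool" where
  "FC_object C F \<longleftrightarrow> is_set_functor C F \<and> preserves_finite_coproducts C F"

text \<open>The two functors may take values in sets over different types, since HOL has no type of
  all sets.\<close>

definition FC_isomorphic ::
  "('o, 'm) cat \<Rightarrow> ('o, 'm, 'v) set_functor \<Rightarrow> ('o, 'm, 'w) set_functor \<Rightarrow> bool" where
  "FC_isomorphic C F G \<longleftrightarrow> FC_object C F \<and> FC_object C G \<and> (\<exists>\<eta>. natural_iso C F G \<eta>)"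


section \<open>Summands and ultrafilters on an object of an extensive category\<close>

definition coprojections :: "('o, 'm) cat \<Rightarrow> 'o \<Rightarrow> 'm set" where
  "coprojections C c = {u. Cod C u = c \<and> (\<exists>u'. is_coproduct C u u')}"

definition summand_class :: "('o, 'm) cat \<Rightarrow> 'm \<Rightarrow> 'm set" where
  "summand_class C u = {v \<in> coprojections C (Cod C u).
     \<exists>k. is_iso C k \<and> Dom C k = Dom C v \<and> Cod C k = Dom C u \<and> Comp C u k = v}"

definition Summands :: "('o, 'm) cat \<Rightarrow> 'o \<Rightarrow> 'm set set" where
  "Summands C c = summand_class C ` coprojections C c"

definition summand_le :: "('o, 'm) cat \<Rightarrow> 'm set \<Rightarrow> 'm set \<Rightarrow> bool" where
  "summand_le C S T \<longleftrightarrow> (\<exists>u\<in>S. \<exists>v\<in>T. \<exists>k\<in>Arr C.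
     Dom C k = Dom C u \<and> Cod C k = Dom C v \<and> Comp C v k = u)"

definition summand_complement :: "('o, 'm) cat \<Rightarrow> 'm set \<Rightarrow> 'm set \<Rightarrow> bool" where
  "summand_complement C S T \<longleftrightarrow> (\<exists>u\<in>S. \<exists>v\<in>T. is_coproduct C u v)"

text \<open>The inverse image \<open>f\<^sup>-\<^sup>1(S)\<close>: in an extensive category, the pullbacks along \<open>f\<close> of the members
  of an isomorphism class of coprojections form such a class themselves. Likewise \<open>Comp C u ` S\<close>
  is the class of the composites of the members of \<open>S\<close> with a coprojection \<open>u\<close>.\<close>

definition inverse_image :: "('o, 'm) cat \<Rightarrow> 'm \<Rightarrow> 'm set \<Rightarrow> 'm set" where
  "inverse_image C f S = {p. \<exists>v\<in>S. \<exists>q. is_pullback C f v p q}"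

definition beta :: "('o, 'm) cat \<Rightarrow> 'o \<Rightarrow> 'm set set set" where
  "beta C c = {\<U>. \<U> \<subseteq> Summands C c \<and> \<U> \<noteq> {} \<and>
     (\<forall>S\<in>\<U>. \<forall>T\<in>Summands C c. summand_le C S T \<longrightarrow> T \<in> \<U>) \<and>
     (\<forall>S\<in>\<U>. \<forall>T\<in>\<U>. \<exists>R\<in>\<U>. summand_le C R S \<and> summand_le C R T) \<and>
     (\<forall>S\<in>Summands C c. \<forall>T\<in>Summands C c. summand_complement C S T \<longrightarrow> (S \<in> \<U> \<longleftrightarrow> T \<notin> \<U>))}"

definition push :: "('o, 'm) cat \<Rightarrow> 'm \<Rightarrow> 'm set set \<Rightarrow> 'm set set" where
  "push C f \<U> = {S \<in> Summands C (Cod C f). inverse_image C f S \<in> \<U>}"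


section \<open>The category of ultrafilters\<close>

text \<open>A partial map \<open>c \<rightharpoonup> d\<close> is a pair \<open>(u, f)\<close> of a coprojection \<open>u\<close> into \<open>c\<close>, representing a
  member of \<open>\<U>\<close>, and an arrow \<open>f\<close> from the domain of \<open>u\<close> to \<open>d\<close>.\<close>

definition partial_maps :: "('o, 'm) cat \<Rightarrow> 'o \<times> 'm set set \<Rightarrow> 'o \<Rightarrow> ('m \<times> 'm) set" where
  "partial_maps C = (\<lambda>(c, \<U>) d. {(u, f). u \<in> coprojections C c \<and> summand_class C u \<in> \<U> \<and>
     f \<in> Arr C \<and> Dom C f = Dom C u \<and> Cod C f = d})"

definition continuous_map ::
  "('o, 'm) cat \<Rightarrow> 'o \<times> 'm set set \<Rightarrow> 'o \<times> 'm set set \<Rightarrow> 'm \<times> 'm \<Rightarrow> bool" where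
  "continuous_map C = (\<lambda>(c, \<U>) (d, \<V>) (u, f).
     (\<forall>S\<in>Summands C d. S \<in> \<V> \<longleftrightarrow> Comp C u ` inverse_image C f S \<in> \<U>))"

definition coincide :: "('o, 'm) cat \<Rightarrow> 'o \<times> 'm set set \<Rightarrow> 'm \<times> 'm \<Rightarrow> 'm \<times> 'm \<Rightarrow> bool" where
  "coincide C = (\<lambda>(c, \<U>) (u, f) (v, g).
     (\<exists>w\<in>coprojections C c. summand_class C w \<in> \<U> \<and>
       (\<exists>h\<in>Arr C. \<exists>k\<in>Arr C.
          Dom C h = Dom C w \<and> Cod C h = Dom C u \<and> Comp C u h = w \<and>
          Dom C k = Dom C w \<and> Cod C k = Dom C v \<and> Comp C v k = w \<and>
          Comp C f h = Comp C g k)))"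

definition germ :: "('o, 'm) cat \<Rightarrow> 'o \<times> 'm set set \<Rightarrow> 'm \<times> 'm \<Rightarrow> ('m \<times> 'm) set" where
  "germ C P = (\<lambda>(u, f). {(v, g) \<in> partial_maps C P (Cod C f). coincide C P (u, f) (v, g)})"

text \<open>The composite of partial maps \<open>(u, f)\<close> and \<open>(v, g)\<close> is defined on the pullback of \<open>v\<close>
  along \<open>f\<close>.\<close>

definition UF :: "('o, 'm) cat \<Rightarrow>
    ('o \<times> 'm set set, ('o \<times> 'm set set) \<times> ('o \<times> 'm set set) \<times> ('m \<times> 'm) set) cat" where
  "UF C = \<lparr>
     Obj = {(c, \<U>). c \<in> Obj C \<and> \<U> \<in> beta C c},
     Arr = {(P, Q, germ C P m) | P Q m.
              fst P \<in> Obj C \<and> snd P \<in> beta C (fst P) \<and> fst Q \<in> Obj C \<and> snd Q \<in> beta C (fst Q) \<and>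
              m \<in> partial_maps C P (fst Q) \<and> continuous_map C P Q m},
     Dom = (\<lambda>(P, Q, F). P),
     Cod = (\<lambda>(P, Q, F). Q),
     Ident = (\<lambda>P. (P, P, germ C P (Ident C (fst P), Ident C (fst P)))),
     Comp = (\<lambda>(Q', R, G) (P, Q, F).
              (P, R, \<Union>{germ C P (Comp C u p, Comp C g q) | u f v g p q.
                         (u, f) \<in> F \<and> (v, g) \<in> G \<and> is_pullback C f v p q}))\<rparr>"

definition integral ::
  "('o, 'm) cat \<Rightarrow>
   ('o \<times> 'm set set, ('o \<times> 'm set set) \<times> ('o \<times> 'm set set) \<times> ('m \<times> 'm) set, 'v) set_functor \<Rightarrow>
   ('o, 'm, 'm set set \<times> 'v) set_functor" where
  "integral C B = \<lparr>
     On_obj = (\<lambda>d. SIGMA \<V>:beta C d. On_obj B (d, \<V>)),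
     On_arr = (\<lambda>f (\<V>, a).
       (push C f \<V>,
        On_arr B ((Dom C f, \<V>), (Cod C f, push C f \<V>),
                  germ C (Dom C f, \<V>) (Ident C (Dom C f), f)) a))\<rparr>"


section \<open>Families of sets and ultraproducts\<close>

text \<open>\<open>Fam X\<close> is the category of \<open>X\<close>-indexed families of sets of elements of \<open>'u\<close>. To make
  families and their maps unique as functions, a family is empty outside \<open>X\<close> and a component of a
  map is \<open>undefined\<close> outside its domain. The type \<open>'u\<close> plays the role of a universe; it is
  infinite so that finite coproducts exist.\<close>

type_synonym ('x, 'u) family = "'x \<Rightarrow> 'u set"
type_synonym ('x, 'u) family_map = "('x, 'u) family \<times> ('x, 'u) family \<times> ('x \<Rightarrow> 'u \<Rightarrow> 'u)"

definition families :: "'x set \<Rightarrow> ('x, 'u) family set" where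
  "families X = {A. \<forall>x. x \<notin> X \<longrightarrow> A x = {}}"

definition Fam :: "'x set \<Rightarrow> (('x, 'u::infinite) family, ('x, 'u) family_map) cat" where
  "Fam X = \<lparr>
     Obj = families X,
     Arr = {(A, B, f). A \<in> families X \<and> B \<in> families X \<and> (\<forall>x. f x \<in> A x \<rightarrow>\<^sub>E B x)},
     Dom = (\<lambda>(A, B, f). A),
     Cod = (\<lambda>(A, B, f). B),
     Ident = (\<lambda>A. (A, A, \<lambda>x. restrict (\<lambda>a. a) (A x))),
     Comp = (\<lambda>(B', D, g) (A, B, f). (A, D, \<lambda>x. compose (A x) (g x) (f x)))\<rparr>"

definition ultrafilter_on :: "'s set \<Rightarrow> 's set set \<Rightarrow> bool" where
  "ultrafilter_on S \<U> \<longleftrightarrow> \<U> \<subseteq> Pow S \<and> S \<in> \<U> \<and> {} \<notin> \<U> \<and>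
     (\<forall>U\<in>\<U>. \<forall>V\<in>\<U>. U \<inter> V \<in> \<U>) \<and>
     (\<forall>U\<in>\<U>. \<forall>V. U \<subseteq> V \<and> V \<subseteq> S \<longrightarrow> V \<in> \<U>) \<and>
     (\<forall>U. U \<subseteq> S \<longrightarrow> U \<in> \<U> \<or> S - U \<in> \<U>)"

text \<open>\<open>X.A\<close> is \<open>Sigma X A\<close>. The identification of the summands of \<open>A\<close> with the subsets of \<open>X.A\<close>
  sends a coprojection to its image; \<open>object_ultrafilter\<close> is the resulting identification of
  ultrafilters on the set \<open>X.A\<close> with ultrafilters on the object \<open>A\<close>.\<close>

definition total_image :: "'x set \<Rightarrow> ('x, 'u) family_map \<Rightarrow> ('x \<times> 'u) set" where
  "total_image X = (\<lambda>(A, B, f). (\<lambda>(x, a). (x, f x a)) ` Sigma X A)"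

definition object_ultrafilter ::
  "'x set \<Rightarrow> ('x, 'u::infinite) family \<Rightarrow> ('x \<times> 'u) set set \<Rightarrow> ('x, 'u) family_map set set" where
  "object_ultrafilter X A \<U> = {S \<in> Summands (Fam X) A. \<exists>u\<in>S. total_image X u \<in> \<U>}"

definition reindex :: "'t set \<Rightarrow> ('t \<Rightarrow> 'x) \<Rightarrow>
    (('x, 'u) family, ('x, 'u) family_map, ('t, 'u) family, ('t, 'u) family_map) func" where
  "reindex T p = (let R = (\<lambda>Y t. if t \<in> T then Y (p t) else {}) in \<lparr>
     On_obj = R,
     On_arr = (\<lambda>(Y, Z, g). (R Y, R Z, \<lambda>t. if t \<in> T then g (p t) else (\<lambda>_. undefined)))\<rparr>)"

text \<open>A partial section of \<open>S.Y \<rightarrow> S\<close> is given by its second components, as a partial function.\<close>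

definition partial_sections :: "'s set set \<Rightarrow> ('s, 'u) family \<Rightarrow> ('s \<rightharpoonup> 'u) set" where
  "partial_sections \<U> Y = {\<sigma>. dom \<sigma> \<in> \<U> \<and> (\<forall>s y. \<sigma> s = Some y \<longrightarrow> y \<in> Y s)}"

definition section_eq ::
  "'s set set \<Rightarrow> ('s, 'u) family \<Rightarrow> (('s \<rightharpoonup> 'u) \<times> ('s \<rightharpoonup> 'u)) set" where
  "section_eq \<U> Y = {(\<sigma>, \<tau>). \<sigma> \<in> partial_sections \<U> Y \<and> \<tau> \<in> partial_sections \<U> Y \<and>
     (\<exists>W\<in>\<U>. \<forall>s\<in>W. \<exists>y. \<sigma> s = Some y \<and> \<tau> s = Some y)}"

definition ultraproduct ::
  "'s set set \<Rightarrow> (('s, 'u) family, ('s, 'u) family_map, ('s \<rightharpoonup> 'u) set) set_functor" where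
  "ultraproduct \<U> = \<lparr>
     On_obj = (\<lambda>Y. partial_sections \<U> Y // section_eq \<U> Y),
     On_arr = (\<lambda>(Y, Z, g) c. \<Union>\<sigma>\<in>c. section_eq \<U> Z `` {\<lambda>s. map_option (g s) (\<sigma> s)})\<rparr>"

end

theory Submission
  imports Defs
begin

text \<open>A partial map \<open>(u, f)\<close> from \<open>A\<close> to \<open>D\<close> is the same thing as a partial section of the family
  \<open>D \<circ> \<pi>\<^sub>A\<close> over \<open>X.A\<close>, defined on the image of \<open>u\<close>; two partial maps are identified modulo \<open>\<U>\<close> if and only if the
  sections are, so the germs of partial maps into \<open>D\<close> form the ultraproduct of \<open>D \<circ> \<pi>\<^sub>A\<close>. A partial
  map is continuous for exactly one ultrafilter on \<open>D\<close>, the image of \<open>\<U>\<close>, and hence the sum over all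
  \<open>\<V> \<in> \<beta>D\<close> of the continuous germs \<open>(A, \<U>) \<rightharpoonup> (D, \<V>)\<close> is this same ultraproduct. That finite coproducts
  are preserved only has to be checked for ultraproducts, where it is the primeness of \<open>\<U>\<close>; it is
  transported along the isomorphism to the other side.\<close>

section \<open>Families and their summands\<close>

text \<open>Maps of families are triples, but should be treated as atomic.\<close>

declare split_paired_All [simp del] split_paired_Ex [simp del]

text \<open>The isomorphism is built from the ultraproduct side. A germ in \<open>UF\<close> is
  itself a set of partial maps, so a class of sections determines one as a preimage under
  \<open>section_of\<close>, and no representative has to be chosen. The functor laws for the
  integral are then read off those of the ultraproduct by naturality instead of from an analysis of
  composition in \<open>UF\<close>. What remains of that composition sits in the naturality square:
  it is a union of germs over all representatives of both factors and over all pullbacks, so it must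
  be shown that all these germs coincide (\<open>compose_germ\<close>) and that there is at least
  one of them (\<open>points_arr\<close>). The categorical notions are first translated into sets: a
  summand of \<open>A\<close> is the class of all coprojections with a given image in
  \<open>X.A\<close>, inverse image is preimage, composition with a coprojection is direct image,
  and \<open>beta\<close> speaks of ultrafilters of subsets. The translation works because subsets
  of \<open>X.A\<close> have complements, so that each injective map is a coprojection.\<close>

definition src :: "('x, 'u) family_map \<Rightarrow> ('x, 'u) family" where "src f = fst f"
definition tgt :: "('x, 'u) family_map \<Rightarrow> ('x, 'u) family" where "tgt f = fst (snd f)"
definition act :: "('x, 'u) family_map \<Rightarrow> 'x \<Rightarrow> 'u \<Rightarrow> 'u" where "act f = snd (snd f)"

lemma family_map_simps [simp]: "src (A, B, f) = A" "tgt (A, B, f) = B" "act (A, B, f) = f"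
  by (simp_all add: src_def tgt_def act_def)

lemma family_map_eqI: "src f = src g \<Longrightarrow> tgt f = tgt g \<Longrightarrow> act f = act g \<Longrightarrow> f = g"
  by (cases f; cases g) simp

lemma Fam_Obj [simp]: "Obj (Fam X) = families X"
  by (simp add: Fam_def)

lemma Fam_Dom [simp]: "Dom (Fam X) f = src f"
  by (cases f) (simp add: Fam_def)

lemma Fam_Cod [simp]: "Cod (Fam X) f = tgt f"
  by (cases f) (simp add: Fam_def)

lemma Fam_Arr_iff:
  "f \<in> Arr (Fam X) \<longleftrightarrow>
     src f \<in> families X \<and> tgt f \<in> families X \<and> (\<forall>x. act f x \<in> src f x \<rightarrow>\<^sub>E tgt f x)"
  by (cases f) (simp add: Fam_def)

lemma src_families: "f \<in> Arr (Fam X) \<Longrightarrow> src f \<in> families X"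
  and tgt_families: "f \<in> Arr (Fam X) \<Longrightarrow> tgt f \<in> families X"
  and act_in: "f \<in> Arr (Fam X) \<Longrightarrow> a \<in> src f x \<Longrightarrow> act f x a \<in> tgt f x"
  by (auto simp: Fam_Arr_iff)

lemma index_in: "A \<in> families X \<Longrightarrow> a \<in> A x \<Longrightarrow> x \<in> X"
  by (auto simp: families_def)

lemma arr_eqI:
  assumes "f \<in> Arr (Fam X)" "g \<in> Arr (Fam X)" "src f = src g" "tgt f = tgt g"
    and "\<And>x a. a \<in> src f x \<Longrightarrow> act f x a = act g x a"
  shows "f = g"
proof -
  have "act f x = act g x" for x
    using assms by (intro extensionalityI[of _ "src f x"]) (auto simp: Fam_Arr_iff PiE_def)
  then show ?thesis
    using assms(3,4) by (intro family_map_eqI) auto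
qed

definition mk_arr :: "('x, 'u) family \<Rightarrow> ('x, 'u) family \<Rightarrow> ('x \<Rightarrow> 'u \<Rightarrow> 'u) \<Rightarrow> ('x, 'u) family_map"
  where "mk_arr A B h = (A, B, \<lambda>x. restrict (h x) (A x))"

lemma mk_arr_simps [simp]:
  "src (mk_arr A B h) = A" "tgt (mk_arr A B h) = B"
  "a \<in> A x \<Longrightarrow> act (mk_arr A B h) x a = h x a"
  by (auto simp: mk_arr_def)

lemma mk_arr_in:
  assumes "A \<in> families X" "B \<in> families X" "\<And>x a. a \<in> A x \<Longrightarrow> h x a \<in> B x"
  shows "mk_arr A B h \<in> Arr (Fam X)"
  using assms by (auto simp: Fam_Arr_iff mk_arr_def)

lemma Fam_Comp_simps [simp]:
  "src (Comp (Fam X) g f) = src f" "tgt (Comp (Fam X) g f) = tgt g"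
  "a \<in> src f x \<Longrightarrow> act (Comp (Fam X) g f) x a = act g x (act f x a)"
  by (cases f; cases g; simp add: Fam_def compose_def)+

lemma Fam_Comp_in:
  "f \<in> Arr (Fam X) \<Longrightarrow> g \<in> Arr (Fam X) \<Longrightarrow> src g = tgt f \<Longrightarrow> Comp (Fam X) g f \<in> Arr (Fam X)"
  by (cases f; cases g) (auto simp: Fam_Arr_iff Fam_def compose_def)

lemma Fam_Ident_simps [simp]:
  "src (Ident (Fam X) A) = A" "tgt (Ident (Fam X) A) = A"
  "a \<in> A x \<Longrightarrow> act (Ident (Fam X) A) x a = a"
  by (auto simp: Fam_def)

lemma Fam_Ident_in: "A \<in> families X \<Longrightarrow> Ident (Fam X) A \<in> Arr (Fam X)"
  by (auto simp: Fam_Arr_iff Fam_def)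

lemma act_Comp_eqD:
  assumes "Comp (Fam X) g f = Comp (Fam X) g' f'" "a \<in> src f x"
  shows "act g x (act f x a) = act g' x (act f' x a)"
proof -
  have "src f = src f'"
    using arg_cong[OF assms(1), of src] by simp
  then show ?thesis
    using arg_cong[OF assms(1), of "\<lambda>h. act h x a"] assms(2) by simp
qed

lemma act_Comp_eq:
  "Comp (Fam X) g f = h \<Longrightarrow> a \<in> src f x \<Longrightarrow> act g x (act f x a) = act h x a"
  by auto

text \<open>The infinitude of \<open>'u\<close> enters here: it provides the two values by which
  maps into a constant family tell points apart, both for coproducts and for initial
  families.\<close>

lemma two_elements: "\<exists>p q :: 'u::infinite. p \<noteq> q"
  by (metis (full_types) UNIV_I ex_new_if_finite finite.emptyI finite.insertI infinite_UNIV singletonI)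

text \<open>From left to right: maps into a constant family with two elements separate points and detect
  elements outside the images.\<close>

lemma Fam_coproduct_iff:
  fixes i j :: "('x, 'u::infinite) family_map"
  shows "is_coproduct (Fam X) i j \<longleftrightarrow>
    i \<in> Arr (Fam X) \<and> j \<in> Arr (Fam X) \<and> tgt i = tgt j \<and>
    (\<forall>x. inj_on (act i x) (src i x) \<and> inj_on (act j x) (src j x) \<and>
         act i x ` src i x \<inter> act j x ` src j x = {} \<and>
         act i x ` src i x \<union> act j x ` src j x = tgt i x)"
    (is "?L \<longleftrightarrow> ?R")
proof
  assume L: ?L
  then have i: "i \<in> Arr (Fam X)" and j: "j \<in> Arr (Fam X)" and ij: "tgt i = tgt j"
    by (auto simp: is_coproduct_def)
  have L': "\<exists>!h. h \<in> Arr (Fam X) \<and> src h = tgt i \<and> tgt h = tgt f \<and>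
              Comp (Fam X) h i = f \<and> Comp (Fam X) h j = g"
    if "f \<in> Arr (Fam X)" "g \<in> Arr (Fam X)" "src f = src i" "src g = src j" "tgt f = tgt g" for f g
    by (rule L[unfolded is_coproduct_def Fam_Dom Fam_Cod,
          THEN conjunct2, THEN conjunct2, THEN conjunct2, rule_format])
      (use that in auto)
  obtain p q :: 'u where pq: "p \<noteq> q"
    using two_elements by blast
  define E where "E = (\<lambda>x. if x \<in> X then {p, q} else {})"
  have E: "E \<in> families X"
    by (auto simp: E_def families_def)
  have ind: "mk_arr A E (\<lambda>x a. if P x a then p else q) \<in> Arr (Fam X)" if "A \<in> families X" for A P
    using index_in[OF that] by (intro mk_arr_in that E) (auto simp: E_def)
  \<comment> \<open>The universal property glues a predicate on each source to one map on the common
    target. Suitable predicates give the injectivity of \<open>i\<close> and of \<open>j\<close> and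
    the disjointness of their images.\<close>
  have sep: "\<exists>h. h \<in> Arr (Fam X) \<and> src h = tgt i \<and>
       (\<forall>x. \<forall>a\<in>src i x. act h x (act i x a) = (if P x a then p else q)) \<and>
       (\<forall>x. \<forall>b\<in>src j x. act h x (act j x b) = (if Q x b then p else q))" for P Q
  proof -
    obtain h where h: "h \<in> Arr (Fam X)" "src h = tgt i"
      and hi: "Comp (Fam X) h i = mk_arr (src i) E (\<lambda>x a. if P x a then p else q)"
      and hj: "Comp (Fam X) h j = mk_arr (src j) E (\<lambda>x a. if Q x a then p else q)"
      using L'[OF ind[OF src_families[OF i], of P] ind[OF src_families[OF j], of Q]]
      by simp blast
    have "act h x (act i x a) = (if P x a then p else q)" if "a \<in> src i x" for x a
      using arg_cong[OF hi, of "\<lambda>k. act k x a"] that by simp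
    moreover have "act h x (act j x a) = (if Q x a then p else q)" if "a \<in> src j x" for x a
      using arg_cong[OF hj, of "\<lambda>k. act k x a"] that by simp
    ultimately show ?thesis
      using h by blast
  qed
  have "inj_on (act i x) (src i x)" for x
  proof (rule inj_onI)
    fix a b assume ab: "a \<in> src i x" "b \<in> src i x" "act i x a = act i x b"
    from sep[of "\<lambda>_ c. c = a" "\<lambda>_ _. True"] show "a = b"
      using ab pq by metis
  qed
  moreover have "inj_on (act j x) (src j x)" for x
  proof (rule inj_onI)
    fix a b assume ab: "a \<in> src j x" "b \<in> src j x" "act j x a = act j x b"
    from sep[of "\<lambda>_ _. True" "\<lambda>_ c. c = a"] show "a = b"
      using ab pq by metis
  qed
  moreover have "act i x ` src i x \<inter> act j x ` src j x = {}" for x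
    using sep[of "\<lambda>_ _. True" "\<lambda>_ _. False"] pq by (auto simp: set_eq_iff) (metis)
  moreover have "act i x ` src i x \<union> act j x ` src j x = tgt i x" for x
  proof (rule ccontr)
    assume "\<not> ?thesis"
    then obtain c where c: "c \<in> tgt i x" "c \<notin> act i x ` src i x \<union> act j x ` src j x"
      using act_in[OF i] act_in[OF j] ij by auto
    \<comment> \<open>The indicator of the empty predicate and that of the point \<open>c\<close>
      over \<open>x\<close> have the same composites with \<open>i\<close> and with
      \<open>j\<close>, because \<open>c\<close> is missed by both; uniqueness would make them
      equal.\<close>
    define h where "h P = mk_arr (tgt i) E (\<lambda>x a. if P x a then p else q)" for P
    have h_src: "src (h P) = tgt i" and h_tgt: "tgt (h P) = E" for P
      by (simp_all add: h_def)
    have h: "h P \<in> Arr (Fam X)" for P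
      unfolding h_def by (intro ind tgt_families i)
    let ?k = "h (\<lambda>_ _. False)" and ?l = "h (\<lambda>y b. y = x \<and> b = c)"
    have hc: "Comp (Fam X) (h P) i \<in> Arr (Fam X)" "Comp (Fam X) (h P) j \<in> Arr (Fam X)" for P
      using h i j ij by (auto intro!: Fam_Comp_in simp: h_def)
    have "Comp (Fam X) ?l i = Comp (Fam X) ?k i"
      using c(2) act_in[OF i] by (intro arr_eqI[of _ X] hc) (auto simp: h_def)
    moreover have "Comp (Fam X) ?l j = Comp (Fam X) ?k j"
      using c(2) act_in[OF j] ij by (intro arr_eqI[of _ X] hc) (auto simp: h_def)
    moreover have "\<exists>!m. m \<in> Arr (Fam X) \<and> src m = tgt i \<and> tgt m = E \<and>
        Comp (Fam X) m i = Comp (Fam X) ?k i \<and> Comp (Fam X) m j = Comp (Fam X) ?k j"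
      using L'[OF hc, of "\<lambda>_ _. False" "\<lambda>_ _. False"] by (simp add: h_def)
    ultimately have "?k = ?l"
      using h[of "\<lambda>_ _. False"] h[of "\<lambda>y b. y = x \<and> b = c"]
      unfolding Ex1_def by (metis h_src h_tgt)
    from arg_cong[OF this, of "\<lambda>k. act k x c"] show False
      using c pq by (simp add: h_def)
  qed
  ultimately show ?R
    using i j ij by blast
next
  assume R: ?R
  then have i: "i \<in> Arr (Fam X)" and j: "j \<in> Arr (Fam X)" and ij: "tgt i = tgt j"
    and inj: "\<And>x. inj_on (act i x) (src i x)" "\<And>x. inj_on (act j x) (src j x)"
    and disj: "\<And>x. act i x ` src i x \<inter> act j x ` src j x = {}"
    and un: "\<And>x. tgt i x = act i x ` src i x \<union> act j x ` src j x"
    by auto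
  have "\<exists>!h. h \<in> Arr (Fam X) \<and> src h = tgt i \<and> tgt h = tgt f \<and>
              Comp (Fam X) h i = f \<and> Comp (Fam X) h j = g"
    if f: "f \<in> Arr (Fam X)" and g: "g \<in> Arr (Fam X)"
      and fg: "src f = src i" "src g = src j" "tgt f = tgt g" for f g
  proof (rule ex_ex1I)
    define h where "h = mk_arr (tgt i) (tgt f)
      (\<lambda>x c. if c \<in> act i x ` src i x then act f x (inv_into (src i x) (act i x) c)
             else act g x (inv_into (src j x) (act j x) c))"
    have h: "h \<in> Arr (Fam X)"
      unfolding h_def
    proof (intro mk_arr_in tgt_families[OF i] tgt_families[OF f])
      fix x c assume "c \<in> tgt i x"
      with un have "c \<in> act i x ` src i x \<or> c \<in> act j x ` src j x" by blast
      then show "(if c \<in> act i x ` src i x then act f x (inv_into (src i x) (act i x) c)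
             else act g x (inv_into (src j x) (act j x) c)) \<in> tgt f x"
        using act_in[OF f, of _ x] act_in[OF g, of _ x] fg inv_into_into[of c]
        by (metis (no_types, lifting))
    qed
    have "Comp (Fam X) h i = f"
      using fg inj(1) act_in[OF i]
      by (intro arr_eqI[of _ X] Fam_Comp_in i h f) (auto simp: h_def)
    moreover have "Comp (Fam X) h j = g"
    proof (intro arr_eqI[of _ X] Fam_Comp_in j h g)
      fix x a assume "a \<in> src (Comp (Fam X) h j) x"
      then have a: "a \<in> src j x" by simp
      then have "act j x a \<notin> act i x ` src i x" "act j x a \<in> tgt i x"
        using disj[of x] act_in[OF j a] ij by auto
      then show "act (Comp (Fam X) h j) x a = act g x a"
        using a inj(2)[of x] by (simp add: h_def)
    qed (use fg ij in \<open>auto simp: h_def\<close>)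
    ultimately show "\<exists>h. h \<in> Arr (Fam X) \<and> src h = tgt i \<and> tgt h = tgt f \<and>
              Comp (Fam X) h i = f \<and> Comp (Fam X) h j = g"
      using h by (intro exI[of _ h]) (simp add: h_def)
  next
    fix h k
    assume h: "h \<in> Arr (Fam X) \<and> src h = tgt i \<and> tgt h = tgt f \<and>
              Comp (Fam X) h i = f \<and> Comp (Fam X) h j = g"
      and k: "k \<in> Arr (Fam X) \<and> src k = tgt i \<and> tgt k = tgt f \<and>
              Comp (Fam X) k i = f \<and> Comp (Fam X) k j = g"
    then have ei: "Comp (Fam X) h i = Comp (Fam X) k i" and ej: "Comp (Fam X) h j = Comp (Fam X) k j"
      by auto
    show "h = k"
      using h k act_Comp_eqD[OF ei] act_Comp_eqD[OF ej] un
      by (intro arr_eqI[of h X k]) auto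
  qed
  with i j ij show ?L
    by (auto simp: is_coproduct_def)
qed

section \<open>Images in the total set, and coprojections\<close>

lemma in_total_image:
  "u \<in> Arr (Fam X) \<Longrightarrow> (x, y) \<in> total_image X u \<longleftrightarrow> (\<exists>a\<in>src u x. act u x a = y)"
  using index_in[OF src_families, of u X]
  by (cases u) (auto simp: total_image_def image_iff)

lemma total_image_subset: "u \<in> Arr (Fam X) \<Longrightarrow> total_image X u \<subseteq> Sigma X (tgt u)"
  using act_in[of u X] index_in[OF src_families, of u X] by (auto simp: in_total_image)

text \<open>The standard coprojection with image \<open>W\<close>, used wherever a summand has to be
  produced from a subset of \<open>X.A\<close>.\<close>

definition inclusion :: "('x, 'u) family \<Rightarrow> ('x \<times> 'u) set \<Rightarrow> ('x, 'u) family_map" where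
  "inclusion A W = mk_arr (\<lambda>x. {a. (x, a) \<in> W}) A (\<lambda>x a. a)"

lemma inclusion_simps [simp]:
  "src (inclusion A W) x = {a. (x, a) \<in> W}" "tgt (inclusion A W) = A"
  "(x, a) \<in> W \<Longrightarrow> act (inclusion A W) x a = a"
  by (auto simp: inclusion_def)

lemma inclusion_in: "A \<in> families X \<Longrightarrow> W \<subseteq> Sigma X A \<Longrightarrow> inclusion A W \<in> Arr (Fam X)"
  unfolding inclusion_def by (intro mk_arr_in) (auto simp: families_def)

lemma total_image_inclusion:
  fixes A :: "('x, 'u::infinite) family"
  shows "A \<in> families X \<Longrightarrow> W \<subseteq> Sigma X A \<Longrightarrow> total_image X (inclusion A W) = W"
  using in_total_image[OF inclusion_in[of A X W]] by (auto simp: set_eq_iff)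

text \<open>The inclusion of the complement of the image serves as the second coprojection, so being
  a summand is the pointwise condition of injectivity.\<close>

lemma coprojections_iff:
  "u \<in> coprojections (Fam X) C \<longleftrightarrow>
     u \<in> Arr (Fam X) \<and> tgt u = C \<and> (\<forall>x. inj_on (act u x) (src u x))"
proof
  assume R: "u \<in> Arr (Fam X) \<and> tgt u = C \<and> (\<forall>x. inj_on (act u x) (src u x))"
  define W where "W = Sigma X C - total_image X u"
  have C: "C \<in> families X" and W: "W \<subseteq> Sigma X C"
    using R tgt_families[of u X] by (auto simp: W_def)
  have "is_coproduct (Fam X) u (inclusion C W)"
    unfolding Fam_coproduct_iff
    using R inclusion_in[OF C W] act_in[of u X] index_in[OF C]
    by (auto simp: inj_on_def W_def in_total_image image_iff)
  then show "u \<in> coprojections (Fam X) C"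
    using R by (auto simp: coprojections_def)
qed (auto simp: coprojections_def Fam_coproduct_iff)

lemma coprojection_arr: "u \<in> coprojections (Fam X) C \<Longrightarrow> u \<in> Arr (Fam X)"
  and coprojection_tgt: "u \<in> coprojections (Fam X) C \<Longrightarrow> tgt u = C"
  by (auto simp: coprojections_iff)

lemma coprojection_inj:
  "u \<in> coprojections (Fam X) C \<Longrightarrow> a \<in> src u x \<Longrightarrow> b \<in> src u x \<Longrightarrow> act u x a = act u x b \<Longrightarrow> a = b"
  by (auto simp: coprojections_iff inj_on_def)

lemma inclusion_coprojection:
  "A \<in> families X \<Longrightarrow> W \<subseteq> Sigma X A \<Longrightarrow> inclusion A W \<in> coprojections (Fam X) A"
  by (auto simp: coprojections_iff inclusion_in inj_on_def)

lemma Ident_coprojection: "A \<in> families X \<Longrightarrow> Ident (Fam X) A \<in> coprojections (Fam X) A"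
  by (auto simp: coprojections_iff Fam_Ident_in inj_on_def)

lemma total_image_Ident:
  assumes "A \<in> families X"
  shows "total_image X (Ident (Fam X) A) = Sigma X A"
  using in_total_image[OF Fam_Ident_in[OF assms]] index_in[OF assms] by auto

text \<open>Choosing preimages under \<open>v\<close> pointwise is a map of families. This is the
  source of the mediating arrows later on: isomorphisms of summands, the order between them, legs of
  pullbacks, restrictions of partial maps.\<close>

lemma factor_through:
  assumes v: "v \<in> coprojections (Fam X) C" and f: "f \<in> Arr (Fam X)" "tgt f = C"
    and sub: "total_image X f \<subseteq> total_image X v"
  obtains h where "h \<in> Arr (Fam X)" "src h = src f" "tgt h = src v" "Comp (Fam X) v h = f"
proof -
  note va = coprojection_arr[OF v]
  define h where "h = mk_arr (src f) (src v) (\<lambda>x a. inv_into (src v x) (act v x) (act f x a))"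
  have ex: "act f x a \<in> act v x ` src v x" if "a \<in> src f x" for x a
    using sub in_total_image[OF f(1), of x "act f x a"] in_total_image[OF va, of x "act f x a"] that
    by (auto simp: subset_iff image_iff) metis
  have h: "h \<in> Arr (Fam X)"
    unfolding h_def using ex
    by (intro mk_arr_in src_families[OF f(1)] src_families[OF va] inv_into_into)
  have "Comp (Fam X) v h = f"
    using ex f coprojection_tgt[OF v]
    by (intro arr_eqI[of _ X] Fam_Comp_in h va) (auto simp: h_def f_inv_into_f)
  then show thesis
    using that[OF h] by (simp add: h_def)
qed

lemma total_image_Comp_subset:
  "f \<in> Arr (Fam X) \<Longrightarrow> g \<in> Arr (Fam X) \<Longrightarrow> src g = tgt f \<Longrightarrow>
     total_image X (Comp (Fam X) g f) \<subseteq> total_image X g"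
  using act_in[of f X] by (fastforce simp: in_total_image Fam_Comp_in)

lemma coprojection_cancel:
  assumes v: "v \<in> coprojections (Fam X) C" and f: "f \<in> Arr (Fam X)" "tgt f = src v"
    and g: "g \<in> Arr (Fam X)" "tgt g = src v" and eq: "Comp (Fam X) v f = Comp (Fam X) v g"
  shows "f = g"
proof -
  have s: "src f = src g"
    using arg_cong[OF eq, of src] by simp
  show ?thesis
    using act_Comp_eqD[OF eq] coprojection_inj[OF v] act_in[OF f(1)] act_in[OF g(1)] f g s
    by (intro arr_eqI[of f X g]) metis+
qed

section \<open>Summands as subsets of the total set\<close>

definition sub_class :: "'x set \<Rightarrow> ('x, 'u::infinite) family \<Rightarrow> ('x \<times> 'u) set \<Rightarrow> ('x, 'u) family_map set"
  where "sub_class X C W = {v \<in> coprojections (Fam X) C. total_image X v = W}"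

lemma sub_class_nonempty:
  "C \<in> families X \<Longrightarrow> W \<subseteq> Sigma X C \<Longrightarrow> inclusion C W \<in> sub_class X C W"
  by (simp add: sub_class_def inclusion_coprojection total_image_inclusion)

text \<open>Two coprojections with the same image factor through each other, and the two factors are
  mutually inverse because a coprojection can be cancelled. Conversely, composing with an
  isomorphism does not change the image.\<close>

lemma summand_class_eq:
  assumes u: "u \<in> coprojections (Fam X) C"
  shows "summand_class (Fam X) u = sub_class X C (total_image X u)"
proof (intro set_eqI iffI)
  note ua = coprojection_arr[OF u] and ut = coprojection_tgt[OF u]
  fix v assume "v \<in> summand_class (Fam X) u"
  then obtain k where v: "v \<in> coprojections (Fam X) C" and k: "is_iso (Fam X) k" "tgt k = src u"
    "src k = src v" "Comp (Fam X) u k = v"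
    by (auto simp: summand_class_def ut)
  then obtain l where ka: "k \<in> Arr (Fam X)" and l: "l \<in> Arr (Fam X)" "src l = src u" "tgt l = src k"
    "Comp (Fam X) k l = Ident (Fam X) (src u)"
    by (auto simp: is_iso_def)
  have "total_image X u \<subseteq> total_image X v"
  proof clarify
    fix x y assume "(x, y) \<in> total_image X u"
    then obtain a where a: "a \<in> src u x" "act u x a = y"
      by (auto simp: in_total_image ua)
    have la: "act l x a \<in> src k x"
      using act_in[OF l(1)] a l by simp
    have "act k x (act l x a) = a"
      using act_Comp_eq[OF l(4)] a l(2) by simp
    then have "act v x (act l x a) = y"
      using a la by (simp flip: k(4))
    then show "(x, y) \<in> total_image X v"
      using la k(3) by (auto simp: in_total_image coprojection_arr[OF v])
  qed
  moreover have "total_image X v \<subseteq> total_image X u"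
    using total_image_Comp_subset[OF ka ua] k(2) by (simp add: k(4))
  ultimately show "v \<in> sub_class X C (total_image X u)"
    using v by (auto simp: sub_class_def)
next
  note ua = coprojection_arr[OF u] and ut = coprojection_tgt[OF u]
  fix v assume "v \<in> sub_class X C (total_image X u)"
  then have v: "v \<in> coprojections (Fam X) C" and eq: "total_image X v = total_image X u"
    by (auto simp: sub_class_def)
  note va = coprojection_arr[OF v] and vt = coprojection_tgt[OF v]
  obtain k where k: "k \<in> Arr (Fam X)" "src k = src v" "tgt k = src u" "Comp (Fam X) u k = v"
    using factor_through[OF u va vt] eq by blast
  obtain l where l: "l \<in> Arr (Fam X)" "src l = src u" "tgt l = src v" "Comp (Fam X) v l = u"
    using factor_through[OF v ua ut] eq by blast
  have uk: "act u x (act k x a) = act v x a" if "a \<in> src v x" for x a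
    using act_Comp_eq[OF k(4)] that k(2) by simp
  have vl: "act v x (act l x a) = act u x a" if "a \<in> src u x" for x a
    using act_Comp_eq[OF l(4)] that l(2) by simp
  have "Comp (Fam X) l k = Ident (Fam X) (src v)"
    by (rule coprojection_cancel[OF v])
      (use k(2,3) l(2,3) act_in[OF k(1)] act_in[OF l(1)] in \<open>auto intro!:
        arr_eqI[of "Comp (Fam X) v _" X] Fam_Comp_in va k(1) l(1) Fam_Ident_in src_families simp: vl uk\<close>)
  moreover have "Comp (Fam X) k l = Ident (Fam X) (src u)"
    by (rule coprojection_cancel[OF u])
      (use k(2,3) l(2,3) act_in[OF k(1)] act_in[OF l(1)] in \<open>auto intro!:
        arr_eqI[of "Comp (Fam X) u _" X] Fam_Comp_in ua k(1) l(1) Fam_Ident_in src_families simp: vl uk\<close>)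
  ultimately have "is_iso (Fam X) k"
    unfolding is_iso_def using k(1-3) l(1-3) by (auto intro!: bexI[of _ l])
  then show "v \<in> summand_class (Fam X) u"
    unfolding summand_class_def using v k ut by (auto intro!: exI[of _ k])
qed

lemma Summands_eq:
  assumes "C \<in> families X"
  shows "Summands (Fam X) C = sub_class X C ` Pow (Sigma X C)"
proof (intro set_eqI iffI)
  fix S assume "S \<in> Summands (Fam X) C"
  then obtain u where u: "u \<in> coprojections (Fam X) C" "S = summand_class (Fam X) u"
    by (auto simp: Summands_def)
  moreover have "total_image X u \<subseteq> Sigma X C"
    using total_image_subset[OF coprojection_arr] u coprojection_tgt by blast
  ultimately show "S \<in> sub_class X C ` Pow (Sigma X C)"
    by (auto simp: summand_class_eq)
next
  fix S assume "S \<in> sub_class X C ` Pow (Sigma X C)"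
  then obtain W where W: "W \<subseteq> Sigma X C" "S = sub_class X C W"
    by blast
  have "S = summand_class (Fam X) (inclusion C W)"
    using W assms by (simp add: summand_class_eq[of _ X C] inclusion_coprojection total_image_inclusion)
  then show "S \<in> Summands (Fam X) C"
    using W assms by (auto simp: Summands_def inclusion_coprojection)
qed

text \<open>Together with \<open>summand_complement_iff\<close> this carries the Boolean structure
  of the summands over to the power set of \<open>X.C\<close>, which makes \<open>beta\<close>
  comparable with ultrafilters of sets.\<close>

lemma summand_le_iff:
  assumes C: "C \<in> families X" and W: "W \<subseteq> Sigma X C" "W' \<subseteq> Sigma X C"
  shows "summand_le (Fam X) (sub_class X C W) (sub_class X C W') \<longleftrightarrow> W \<subseteq> W'"
proof
  assume "summand_le (Fam X) (sub_class X C W) (sub_class X C W')"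
  then obtain u v k where "u \<in> sub_class X C W" "v \<in> sub_class X C W'" "k \<in> Arr (Fam X)"
    "tgt k = src v" "Comp (Fam X) v k = u"
    by (auto simp: summand_le_def)
  then show "W \<subseteq> W'"
    using total_image_Comp_subset[of k X v] by (auto simp: sub_class_def coprojections_iff)
next
  assume sub: "W \<subseteq> W'"
  let ?u = "inclusion C W" and ?v = "inclusion C W'"
  obtain h where "h \<in> Arr (Fam X)" "src h = src ?u" "tgt h = src ?v" "Comp (Fam X) ?v h = ?u"
    by (rule factor_through[of ?v X C ?u])
      (use assms sub in \<open>auto simp: inclusion_coprojection inclusion_in total_image_inclusion\<close>)
  then show "summand_le (Fam X) (sub_class X C W) (sub_class X C W')"
    unfolding summand_le_def using sub_class_nonempty[OF C W(1)] sub_class_nonempty[OF C W(2)]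
    by (metis Fam_Cod Fam_Dom)
qed

lemma summand_complement_iff:
  assumes C: "C \<in> families X" and W: "W \<subseteq> Sigma X C" "W' \<subseteq> Sigma X C"
  shows "summand_complement (Fam X) (sub_class X C W) (sub_class X C W') \<longleftrightarrow> W' = Sigma X C - W"
proof
  assume "summand_complement (Fam X) (sub_class X C W) (sub_class X C W')"
  then obtain u v where u: "u \<in> coprojections (Fam X) C" "total_image X u = W"
    and v: "v \<in> coprojections (Fam X) C" "total_image X v = W'"
    and cp: "is_coproduct (Fam X) u v"
    by (auto simp: summand_complement_def sub_class_def)
  have "(x, y) \<in> W' \<longleftrightarrow> (x, y) \<in> Sigma X C - W" for x y
  proof -
    have "act u x ` src u x \<inter> act v x ` src v x = {}" "act u x ` src u x \<union> act v x ` src v x = C x"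
      using cp coprojection_tgt[OF u(1)] by (auto simp: Fam_coproduct_iff)
    moreover have "(x, y) \<in> W' \<longleftrightarrow> y \<in> act v x ` src v x" "(x, y) \<in> W \<longleftrightarrow> y \<in> act u x ` src u x"
      using u v in_total_image[OF coprojection_arr[OF u(1)]] in_total_image[OF coprojection_arr[OF v(1)]]
      by auto
    ultimately show ?thesis
      using index_in[OF C, of y x] by blast
  qed
  then show "W' = Sigma X C - W"
    by auto
next
  assume eq: "W' = Sigma X C - W"
  have "is_coproduct (Fam X) (inclusion C W) (inclusion C W')"
    unfolding Fam_coproduct_iff using assms inclusion_in[OF C W(1)] inclusion_in[OF C W(2)] index_in[OF C]
    by (auto simp: inj_on_def eq image_iff)
  then show "summand_complement (Fam X) (sub_class X C W) (sub_class X C W')"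
    using sub_class_nonempty[OF C W(1)] sub_class_nonempty[OF C W(2)]
    by (auto simp: summand_complement_def)
qed

text \<open>Commutativity of the square already puts the image of \<open>p\<close> inside the
  preimage of the image of \<open>v\<close>, so only the reverse inclusion is listed. Conversely,
  that inclusion lets every competing leg \<open>s\<close> factor through \<open>p\<close>.\<close>

lemma Fam_pullback_iff:
  assumes f: "f \<in> Arr (Fam X)" and v: "v \<in> coprojections (Fam X) (tgt f)"
  shows "is_pullback (Fam X) f v p q \<longleftrightarrow>
    p \<in> coprojections (Fam X) (src f) \<and> q \<in> Arr (Fam X) \<and> src p = src q \<and> tgt q = src v \<and>
    Comp (Fam X) f p = Comp (Fam X) v q \<and>
    (\<forall>x. \<forall>a\<in>src f x. (x, act f x a) \<in> total_image X v \<longrightarrow> (x, a) \<in> total_image X p)"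
    (is "?L \<longleftrightarrow> ?R")
proof
  note va = coprojection_arr[OF v] and vt = coprojection_tgt[OF v]
  assume L: ?L
  then have p: "p \<in> Arr (Fam X)" "tgt p = src f" and q: "q \<in> Arr (Fam X)" "src p = src q" "tgt q = src v"
    and eq: "Comp (Fam X) f p = Comp (Fam X) v q"
    by (simp_all add: is_pullback_def)
  have univ: "\<And>s t. s \<in> Arr (Fam X) \<Longrightarrow> t \<in> Arr (Fam X) \<Longrightarrow> src s = src t \<Longrightarrow> tgt s = src f \<Longrightarrow>
       tgt t = src v \<Longrightarrow> Comp (Fam X) f s = Comp (Fam X) v t \<Longrightarrow>
        \<exists>!h. h \<in> Arr (Fam X) \<and> src h = src s \<and> tgt h = src p \<and>
              Comp (Fam X) p h = s \<and> Comp (Fam X) q h = t"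
    by (rule L[unfolded is_pullback_def Fam_Dom Fam_Cod, THEN conjunct2, THEN conjunct2,
          THEN conjunct2, THEN conjunct2, THEN conjunct2, THEN conjunct2, THEN conjunct2,
          THEN conjunct2, THEN conjunct2, rule_format])
      auto
  \<comment> \<open>Arrows out of a family whose only element lies over \<open>x\<close> are
    elements over \<open>x\<close>, so the universal property can be tested on elements.\<close>
  have point: "mk_arr (\<lambda>y. if y = x then {a} else {}) B (\<lambda>_ _. b) \<in> Arr (Fam X)"
    if "b \<in> B x" "B \<in> families X" for x a b and B :: "('a, 'b) family"
    using that by (intro mk_arr_in) (auto simp: families_def split: if_splits)
  have "inj_on (act p x) (src p x)" for x
  proof (rule inj_onI)
    fix a b assume ab: "a \<in> src p x" "b \<in> src p x" "act p x a = act p x b"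
    have "act v x (act q x a) = act v x (act q x b)"
      using act_Comp_eqD[OF eq, of a x] act_Comp_eqD[OF eq, of b x] ab by simp
    then have qab: "act q x a = act q x b"
      by (rule coprojection_inj[OF v, rotated -1]) (use act_in[OF q(1)] ab q in auto)
    \<comment> \<open>The arrows picking out \<open>a\<close> and \<open>b\<close> have equal
      composites with \<open>p\<close> by assumption and with \<open>q\<close> because
      \<open>v\<close> is injective. Uniqueness of the mediating arrow identifies them.\<close>
    let ?m = "\<lambda>c. mk_arr (\<lambda>y. if y = x then {a} else {}) (src p) (\<lambda>_ _. c)"
    have m: "?m a \<in> Arr (Fam X)" "?m b \<in> Arr (Fam X)"
      using ab by (auto intro!: point src_families[OF p(1)])
    have "Comp (Fam X) p (?m b) = Comp (Fam X) p (?m a)"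
      by (rule arr_eqI[OF Fam_Comp_in[OF m(2) p(1)] Fam_Comp_in[OF m(1) p(1)]])
        (use ab in \<open>auto split: if_splits\<close>)
    moreover have "Comp (Fam X) q (?m b) = Comp (Fam X) q (?m a)"
      by (rule arr_eqI[OF Fam_Comp_in[OF m(2) q(1)] Fam_Comp_in[OF m(1) q(1)]])
        (use qab q in \<open>auto split: if_splits\<close>)
    ultimately have e: "Comp (Fam X) p (?m b) = Comp (Fam X) p (?m a)"
      "Comp (Fam X) q (?m b) = Comp (Fam X) q (?m a)" .
    have "\<exists>!h. h \<in> Arr (Fam X) \<and> src h = src (Comp (Fam X) p (?m a)) \<and> tgt h = src p \<and>
              Comp (Fam X) p h = Comp (Fam X) p (?m a) \<and> Comp (Fam X) q h = Comp (Fam X) q (?m a)"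
      by (rule univ)
        (use ab qab act_in[OF p(1)] act_in[OF q(1)] act_Comp_eqD[OF eq] q p m vt in
          \<open>auto intro!: Fam_Comp_in f va arr_eqI[of "Comp (Fam X) f _" X] split: if_splits\<close>)
    then have "?m a = ?m b"
      by (rule ex1E) (metis m e mk_arr_simps(1,2) Fam_Comp_simps(1))
    from arg_cong[OF this, of "\<lambda>m. act m x a"] show "a = b"
      by simp
  qed
  moreover have "(x, a) \<in> total_image X p" if a: "a \<in> src f x" and t: "(x, act f x a) \<in> total_image X v" for x a
  proof -
    obtain b where b: "b \<in> src v x" "act v x b = act f x a"
      using t by (auto simp: in_total_image va)
    let ?s = "mk_arr (\<lambda>y. if y = x then {a} else {}) (src f) (\<lambda>_ _. a)"
    let ?t = "mk_arr (\<lambda>y. if y = x then {a} else {}) (src v) (\<lambda>_ _. b)"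
    have st: "?s \<in> Arr (Fam X)" "?t \<in> Arr (Fam X)"
      using a b by (auto intro!: point src_families f va)
    have "\<exists>!h. h \<in> Arr (Fam X) \<and> src h = src ?s \<and> tgt h = src p \<and>
              Comp (Fam X) p h = ?s \<and> Comp (Fam X) q h = ?t"
      by (rule univ)
        (use a b st vt in \<open>auto intro!: Fam_Comp_in f va arr_eqI[of "Comp (Fam X) f _" X] split: if_splits\<close>)
    then obtain h where h: "h \<in> Arr (Fam X)" "src h = src ?s" "tgt h = src p" "Comp (Fam X) p h = ?s"
      by blast
    have "act p x (act h x a) = a"
      using act_Comp_eq[OF h(4), of a x] h(2) by simp
    moreover have "act h x a \<in> src p x"
      using act_in[OF h(1), of a x] h by simp
    ultimately show ?thesis
      by (auto simp: in_total_image p)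
  qed
  ultimately show ?R
    using p q eq by (auto simp: coprojections_iff)
next
  note va = coprojection_arr[OF v] and vt = coprojection_tgt[OF v]
  assume R: ?R
  then have pc: "p \<in> coprojections (Fam X) (src f)" and q: "q \<in> Arr (Fam X)" "src p = src q" "tgt q = src v"
    and eq: "Comp (Fam X) f p = Comp (Fam X) v q"
    and im: "\<And>x a. a \<in> src f x \<Longrightarrow> (x, act f x a) \<in> total_image X v \<Longrightarrow> (x, a) \<in> total_image X p"
    by auto
  note pa = coprojection_arr[OF pc] and pt = coprojection_tgt[OF pc]
  have "\<exists>!h. h \<in> Arr (Fam X) \<and> src h = src s \<and> tgt h = src p \<and>
              Comp (Fam X) p h = s \<and> Comp (Fam X) q h = t"
    if s: "s \<in> Arr (Fam X)" and t: "t \<in> Arr (Fam X)" and st: "src s = src t" "tgt s = src f" "tgt t = src v"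
      and e: "Comp (Fam X) f s = Comp (Fam X) v t" for s t
  proof -
    have "total_image X s \<subseteq> total_image X p"
    proof clarify
      fix x y assume "(x, y) \<in> total_image X s"
      then obtain a where a: "a \<in> src s x" "y = act s x a"
        by (auto simp: in_total_image s)
      have "act f x y = act v x (act t x a)"
        using act_Comp_eqD[OF e] a by simp
      moreover have "y \<in> src f x" "act t x a \<in> src v x"
        using a st act_in[OF s] act_in[OF t] by auto
      ultimately show "(x, y) \<in> total_image X p"
        by (intro im) (auto simp: in_total_image va)
    qed
    then obtain h where h: "h \<in> Arr (Fam X)" "src h = src s" "tgt h = src p" "Comp (Fam X) p h = s"
      using factor_through[OF pc s st(2)] by blast
    \<comment> \<open>Only \<open>p\<close> was used to define \<open>h\<close>; that
      \<open>q\<close> after \<open>h\<close> is \<open>t\<close> is checked after composing with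
      \<open>v\<close>, which is then cancelled.\<close>
    have "Comp (Fam X) v (Comp (Fam X) q h) = Comp (Fam X) v t"
    proof (intro arr_eqI[of _ X] Fam_Comp_in va h q t)
      fix x a assume "a \<in> src (Comp (Fam X) v (Comp (Fam X) q h)) x"
      then have a: "a \<in> src h x" by simp
      then have ha: "act h x a \<in> src p x"
        using act_in[OF h(1)] h by simp
      have "act v x (act q x (act h x a)) = act f x (act p x (act h x a))"
        using act_Comp_eqD[OF eq ha] by simp
      also have "act p x (act h x a) = act s x a"
        using act_Comp_eq[OF h(4)] a by simp
      also have "act f x (act s x a) = act v x (act t x a)"
        using act_Comp_eqD[OF e] a h by simp
      finally show "act (Comp (Fam X) v (Comp (Fam X) q h)) x a = act (Comp (Fam X) v t) x a"
        using a ha h st by simp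
    qed (use h q st in auto)
    then have "Comp (Fam X) q h = t"
      by (rule coprojection_cancel[OF v, rotated -1]) (use h q st t in \<open>auto intro!: Fam_Comp_in\<close>)
    then show ?thesis
      using h coprojection_cancel[OF pc] by (intro ex1I[of _ h]) auto
  qed
  then show ?L
    using pa pt q eq f va vt by (auto simp: is_pullback_def)
qed

section \<open>Ultraproducts preserve finite coproducts\<close>

lemma
  assumes "ultrafilter_on S \<U>"
  shows ultrafilter_subset: "U \<in> \<U> \<Longrightarrow> U \<subseteq> S"
    and ultrafilter_top: "S \<in> \<U>"
    and ultrafilter_empty: "{} \<notin> \<U>"
    and ultrafilter_Int: "U \<in> \<U> \<Longrightarrow> V \<in> \<U> \<Longrightarrow> U \<inter> V \<in> \<U>"
    and ultrafilter_mono: "U \<in> \<U> \<Longrightarrow> U \<subseteq> V \<Longrightarrow> V \<subseteq> S \<Longrightarrow> V \<in> \<U>"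
    and ultrafilter_cases: "U \<subseteq> S \<Longrightarrow> U \<in> \<U> \<or> S - U \<in> \<U>"
  using assms by (auto simp: ultrafilter_on_def)

lemma ultrafilter_Diff:
  assumes "ultrafilter_on S \<U>" "U \<subseteq> S"
  shows "S - U \<in> \<U> \<longleftrightarrow> U \<notin> \<U>"
  using ultrafilter_cases[OF assms] ultrafilter_Int[OF assms(1), of U "S - U"]
    ultrafilter_empty[OF assms(1)] by auto

lemma ultrafilter_Un:
  assumes "ultrafilter_on S \<U>" "U \<union> V \<in> \<U>"
  shows "U \<in> \<U> \<or> V \<in> \<U>"
proof (rule disjCI)
  assume "V \<notin> \<U>"
  have sub: "U \<union> V \<subseteq> S"
    using ultrafilter_subset[OF assms] .
  then have "S - V \<in> \<U>"
    using \<open>V \<notin> \<U>\<close> ultrafilter_cases[OF assms(1), of V] by auto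
  then have "(U \<union> V) \<inter> (S - V) \<in> \<U>"
    by (rule ultrafilter_Int[OF assms])
  then show "U \<in> \<U>"
    by (rule ultrafilter_mono[OF assms(1)]) (use sub in auto)
qed

section \<open>Partial sections and their classes\<close>

lemma partial_sections_iff:
  "\<sigma> \<in> partial_sections \<U> Y \<longleftrightarrow> dom \<sigma> \<in> \<U> \<and> (\<forall>s y. \<sigma> s = Some y \<longrightarrow> y \<in> Y s)"
  by (simp add: partial_sections_def)

lemma section_eqI:
  assumes "\<sigma> \<in> partial_sections \<U> Y" "\<tau> \<in> partial_sections \<U> Y" "W \<in> \<U>"
    and "\<And>s. s \<in> W \<Longrightarrow> \<exists>y. \<sigma> s = Some y \<and> \<tau> s = Some y"
  shows "(\<sigma>, \<tau>) \<in> section_eq \<U> Y"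
  using assms by (auto simp: section_eq_def)

lemma section_eqE:
  assumes "(\<sigma>, \<tau>) \<in> section_eq \<U> Y"
  obtains W where "\<sigma> \<in> partial_sections \<U> Y" "\<tau> \<in> partial_sections \<U> Y" "W \<in> \<U>"
    "\<And>s. s \<in> W \<Longrightarrow> \<exists>y. \<sigma> s = Some y \<and> \<tau> s = Some y"
  using assms by (auto simp: section_eq_def)

lemma equiv_section_eq:
  assumes "ultrafilter_on S \<U>"
  shows "equiv (partial_sections \<U> Y) (section_eq \<U> Y)"
proof (rule equivI)
  show "section_eq \<U> Y \<subseteq> partial_sections \<U> Y \<times> partial_sections \<U> Y"
    by (auto simp: section_eq_def)
  show "refl_on (partial_sections \<U> Y) (section_eq \<U> Y)"
  proof (rule refl_onI)
    fix \<sigma> assume "\<sigma> \<in> partial_sections \<U> Y"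
    then show "(\<sigma>, \<sigma>) \<in> section_eq \<U> Y"
      by (intro section_eqI[of \<sigma> \<U> Y \<sigma> "dom \<sigma>"]) (auto simp: partial_sections_iff)
  qed
  show "sym (section_eq \<U> Y)"
    by (rule symI) (fastforce simp: section_eq_def)
  show "trans (section_eq \<U> Y)"
  proof (rule transI)
    fix \<sigma> \<tau> \<rho> assume "(\<sigma>, \<tau>) \<in> section_eq \<U> Y" "(\<tau>, \<rho>) \<in> section_eq \<U> Y"
    then obtain W W' where W: "W \<in> \<U>" "W' \<in> \<U>" "\<sigma> \<in> partial_sections \<U> Y" "\<rho> \<in> partial_sections \<U> Y"
      "\<And>s. s \<in> W \<Longrightarrow> \<exists>y. \<sigma> s = Some y \<and> \<tau> s = Some y"
      "\<And>s. s \<in> W' \<Longrightarrow> \<exists>y. \<tau> s = Some y \<and> \<rho> s = Some y"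
      by (elim section_eqE) blast
    then show "(\<sigma>, \<rho>) \<in> section_eq \<U> Y"
      using ultrafilter_Int[OF assms W(1,2)] by (intro section_eqI[of _ _ _ _ "W \<inter> W'"]) fastforce+
  qed
qed

lemma section_class_eq_iff:
  assumes "ultrafilter_on S \<U>" "\<sigma> \<in> partial_sections \<U> Y" "\<tau> \<in> partial_sections \<U> Y"
  shows "section_eq \<U> Y `` {\<sigma>} = section_eq \<U> Y `` {\<tau>} \<longleftrightarrow> (\<sigma>, \<tau>) \<in> section_eq \<U> Y"
  using eq_equiv_class_iff[OF equiv_section_eq[OF assms(1)] assms(2,3)] .

lemma ultraproduct_obj: "On_obj (ultraproduct \<U>) Y = partial_sections \<U> Y // section_eq \<U> Y"
  by (simp add: ultraproduct_def)

lemma map_partial_section: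
  assumes "\<sigma> \<in> partial_sections \<U> Y" "\<And>s y. y \<in> Y s \<Longrightarrow> g s y \<in> Z s"
  shows "(\<lambda>s. map_option (g s) (\<sigma> s)) \<in> partial_sections \<U> Z"
proof -
  have "dom (\<lambda>s. map_option (g s) (\<sigma> s)) = dom \<sigma>"
    by auto
  then show ?thesis
    using assms by (auto simp: partial_sections_iff)
qed

text \<open>Sections that agree on a set of the ultrafilter still do so after \<open>g\<close> is
  applied. Hence all the classes in the union that defines the arrow part are equal, and any
  representative computes it.\<close>

lemma ultraproduct_arr:
  assumes U: "ultrafilter_on S \<U>" and \<sigma>: "\<sigma> \<in> partial_sections \<U> Y"
    and g: "\<And>s y. y \<in> Y s \<Longrightarrow> g s y \<in> Z s"
  shows "On_arr (ultraproduct \<U>) (Y, Z, g) (section_eq \<U> Y `` {\<sigma>}) =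
    section_eq \<U> Z `` {\<lambda>s. map_option (g s) (\<sigma> s)}"
proof -
  have "section_eq \<U> Z `` {\<lambda>s. map_option (g s) (\<tau> s)} = section_eq \<U> Z `` {\<lambda>s. map_option (g s) (\<rho> s)}"
    if "(\<tau>, \<rho>) \<in> section_eq \<U> Y" for \<tau> \<rho>
  proof -
    from that obtain W where *: "\<tau> \<in> partial_sections \<U> Y" "\<rho> \<in> partial_sections \<U> Y" "W \<in> \<U>"
      "\<And>s. s \<in> W \<Longrightarrow> \<exists>y. \<tau> s = Some y \<and> \<rho> s = Some y"
      by (elim section_eqE) blast
    have "(\<lambda>s. map_option (g s) (\<tau> s), \<lambda>s. map_option (g s) (\<rho> s)) \<in> section_eq \<U> Z"
      by (rule section_eqI[OF map_partial_section map_partial_section *(3)])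
        (use * g in \<open>fastforce+\<close>)
    then show ?thesis
      using equiv_class_eq[OF equiv_section_eq[OF U]] by blast
  qed
  then have "(\<lambda>\<sigma>. section_eq \<U> Z `` {\<lambda>s. map_option (g s) (\<sigma> s)}) respects section_eq \<U> Y"
    by (intro congruentI)
  from UN_equiv_class[OF equiv_section_eq[OF U] this \<sigma>] show ?thesis
    by (simp add: ultraproduct_def)
qed

lemma bij_betw_case_sum:
  assumes "inj_on f A" "inj_on g B" "\<And>a b. a \<in> A \<Longrightarrow> b \<in> B \<Longrightarrow> f a \<noteq> g b"
    and "f ` A \<union> g ` B = C"
  shows "bij_betw (case_sum f g) (A <+> B) C"
  unfolding bij_betw_def
proof
  show "inj_on (case_sum f g) (A <+> B)"
  proof (rule inj_onI)
    fix s t assume "s \<in> A <+> B" "t \<in> A <+> B" "case_sum f g s = case_sum f g t"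
    then show "s = t"
      using inj_onD[OF assms(1)] inj_onD[OF assms(2)] assms(3)
      by (elim PlusE) (simp_all, metis+)
  qed
  have "case_sum f g ` (A <+> B) = f ` A \<union> g ` B"
    by (simp add: Plus_def image_Un image_image)
  then show "case_sum f g ` (A <+> B) = C"
    using assms(4) by (rule trans)
qed

text \<open>An element over \<open>x\<close> would distinguish two constant maps into a family with
  two values, against uniqueness.\<close>

lemma initial_empty:
  fixes z :: "('x, 'u::infinite) family"
  assumes "is_initial (Fam X) z"
  shows "z x = {}"
proof (rule ccontr)
  assume "z x \<noteq> {}"
  then obtain a where a: "a \<in> z x" by blast
  have z: "z \<in> families X"
    using assms by (simp add: is_initial_def)
  obtain r s :: 'u where rs: "r \<noteq> s"
    using two_elements by blast
  define E where "E = (\<lambda>x. if x \<in> X then {r, s} else {})"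
  have E: "E \<in> families X"
    by (auto simp: E_def families_def)
  have m: "mk_arr z E (\<lambda>_ _. e) \<in> Arr (Fam X)" if "e = r \<or> e = s" for e
    using index_in[OF z] that by (intro mk_arr_in z E) (auto simp: E_def)
  have "\<exists>!f. f \<in> Arr (Fam X) \<and> src f = z \<and> tgt f = E"
    using assms E by (simp add: is_initial_def)
  then have "mk_arr z E (\<lambda>_ _. r) = mk_arr z E (\<lambda>_ _. s)"
    by (rule ex1E) (metis m mk_arr_simps(1,2))
  from arg_cong[OF this, of "\<lambda>f. act f x a"] show False
    using a rs by simp
qed

section \<open>Ultraproducts of families reindexed along a map\<close>

context
  fixes X :: "'x set" and T :: "'t set" and p :: "'t \<Rightarrow> 'x" and \<U> :: "'t set set"
  assumes U: "ultrafilter_on T \<U>"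
begin

abbreviation (input) pulled :: "('x, 'u::infinite) family \<Rightarrow> ('t, 'u) family"
  where "pulled \<equiv> On_obj (reindex T p)"

abbreviation (input) pulled_ultraproduct ::
    "(('x, 'u::infinite) family, ('x, 'u) family_map, ('t \<rightharpoonup> 'u) set) set_functor"
  where "pulled_ultraproduct \<equiv> functor_comp (ultraproduct \<U>) (reindex T p)"

lemma pulled_eq: "pulled Y t = (if t \<in> T then Y (p t) else {})"
  by (simp add: reindex_def Let_def)

text \<open>A domain that belongs to \<open>\<U>\<close> lies inside \<open>T\<close>, which removes
  the case distinction of \<open>reindex\<close>.\<close>

lemma pulled_sections_iff:
  "\<sigma> \<in> partial_sections \<U> (pulled Y) \<longleftrightarrow> dom \<sigma> \<in> \<U> \<and> (\<forall>t y. \<sigma> t = Some y \<longrightarrow> y \<in> Y (p t))"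
  using ultrafilter_subset[OF U, of "dom \<sigma>"]
  by (auto simp: partial_sections_iff pulled_eq domI subset_iff split: if_splits)

lemma pulled_obj:
  "On_obj pulled_ultraproduct Y = partial_sections \<U> (pulled Y) // section_eq \<U> (pulled Y)"
  by (simp add: functor_comp_def ultraproduct_obj)

lemma pulled_post:
  assumes "g \<in> Arr (Fam X)" "\<sigma> \<in> partial_sections \<U> (pulled (src g))"
  shows "(\<lambda>t. map_option (act g (p t)) (\<sigma> t)) \<in> partial_sections \<U> (pulled (tgt g))"
  by (rule map_partial_section[OF assms(2)]) (use act_in[OF assms(1)] in \<open>auto simp: pulled_eq split: if_splits\<close>)

text \<open>A section has no value outside \<open>T\<close>, so the default components that
  \<open>reindex\<close> puts there are never evaluated and \<open>act g (p t)\<close> can be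
  written throughout.\<close>

lemma pulled_arr:
  assumes g: "g \<in> Arr (Fam X)" and \<sigma>: "\<sigma> \<in> partial_sections \<U> (pulled (src g))"
  shows "On_arr pulled_ultraproduct g (section_eq \<U> (pulled (src g)) `` {\<sigma>}) =
    section_eq \<U> (pulled (tgt g)) `` {\<lambda>t. map_option (act g (p t)) (\<sigma> t)}"
proof -
  let ?g = "\<lambda>t. if t \<in> T then act g (p t) else (\<lambda>_. undefined)"
  have R: "On_arr (reindex T p) g = (pulled (src g), pulled (tgt g), ?g)"
    by (cases g) (auto simp: reindex_def Let_def)
  have "(\<lambda>t. map_option (?g t) (\<sigma> t)) = (\<lambda>t. map_option (act g (p t)) (\<sigma> t))"
  proof
    fix t
    show "map_option (?g t) (\<sigma> t) = map_option (act g (p t)) (\<sigma> t)"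
      using \<sigma> by (cases "\<sigma> t") (auto simp: partial_sections_iff pulled_eq split: if_splits)
  qed
  moreover have "?g t y \<in> pulled (tgt g) t" if "y \<in> pulled (src g) t" for t y
    using that act_in[OF g] by (auto simp: pulled_eq split: if_splits)
  ultimately show ?thesis
    using ultraproduct_arr[OF U \<sigma>, of ?g "pulled (tgt g)"] by (simp add: functor_comp_def R)
qed

lemma pulled_classE:
  assumes "c \<in> On_obj pulled_ultraproduct Y"
  obtains \<sigma> where "\<sigma> \<in> partial_sections \<U> (pulled Y)" "c = section_eq \<U> (pulled Y) `` {\<sigma>}"
  using assms unfolding pulled_obj by (elim quotientE)

lemma pulled_classI:
  "\<sigma> \<in> partial_sections \<U> (pulled Y) \<Longrightarrow> section_eq \<U> (pulled Y) `` {\<sigma>} \<in> On_obj pulled_ultraproduct Y"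
  unfolding pulled_obj by (rule quotientI)

lemma pulled_arr_in:
  assumes f: "f \<in> Arr (Fam X)" and c: "c \<in> On_obj pulled_ultraproduct (src f)"
  shows "On_arr pulled_ultraproduct f c \<in> On_obj pulled_ultraproduct (tgt f)"
proof -
  from c obtain \<sigma> where \<sigma>: "\<sigma> \<in> partial_sections \<U> (pulled (src f))" "c = section_eq \<U> (pulled (src f)) `` {\<sigma>}"
    by (rule pulled_classE)
  show ?thesis
    unfolding \<sigma>(2) pulled_arr[OF f \<sigma>(1)] by (rule pulled_classI[OF pulled_post[OF f \<sigma>(1)]])
qed

lemma pulled_is_set_functor:
  "is_set_functor (Fam X :: (('x, 'u::infinite) family, _) cat) pulled_ultraproduct"
  unfolding is_set_functor_def Fam_Dom Fam_Cod Fam_Obj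
proof (intro conjI ballI impI funcsetI)
  fix f :: "('x, 'u) family_map" and c
  assume f: "f \<in> Arr (Fam X)" and c: "c \<in> On_obj pulled_ultraproduct (src f)"
  show "On_arr pulled_ultraproduct f c \<in> On_obj pulled_ultraproduct (tgt f)"
    by (rule pulled_arr_in[OF f c])
  from c obtain \<sigma> where \<sigma>: "\<sigma> \<in> partial_sections \<U> (pulled (src f))" "c = section_eq \<U> (pulled (src f)) `` {\<sigma>}"
    by (rule pulled_classE)
  fix g :: "('x, 'u) family_map"
  assume g: "g \<in> Arr (Fam X)" and fg: "tgt f = src g"
  have \<sigma>': "(\<lambda>t. map_option (act f (p t)) (\<sigma> t)) \<in> partial_sections \<U> (pulled (src g))"
    using pulled_post[OF f \<sigma>(1)] fg by simp
  have gf: "Comp (Fam X) g f \<in> Arr (Fam X)" "\<sigma> \<in> partial_sections \<U> (pulled (src (Comp (Fam X) g f)))"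
    using f g fg \<sigma> by (auto intro: Fam_Comp_in)
  have "map_option (act (Comp (Fam X) g f) (p t)) (\<sigma> t) =
      map_option (act g (p t)) (map_option (act f (p t)) (\<sigma> t))" for t
    using \<sigma>(1) by (cases "\<sigma> t") (auto simp: pulled_sections_iff)
  then show "On_arr pulled_ultraproduct (Comp (Fam X) g f) c =
      On_arr pulled_ultraproduct g (On_arr pulled_ultraproduct f c)"
    using pulled_arr[OF gf] unfolding \<sigma>(2) pulled_arr[OF f \<sigma>(1)] fg pulled_arr[OF g \<sigma>'] by simp
next
  fix Y :: "('x, 'u) family" and c
  assume Y: "Y \<in> families X" and c: "c \<in> On_obj pulled_ultraproduct Y"
  from c obtain \<sigma> where \<sigma>: "\<sigma> \<in> partial_sections \<U> (pulled Y)" "c = section_eq \<U> (pulled Y) `` {\<sigma>}"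
    by (rule pulled_classE)
  have "map_option (act (Ident (Fam X) Y) (p t)) (\<sigma> t) = \<sigma> t" for t
    using \<sigma>(1) by (cases "\<sigma> t") (auto simp: pulled_sections_iff)
  then show "On_arr pulled_ultraproduct (Ident (Fam X) Y) c = c"
    using pulled_arr[OF Fam_Ident_in[OF Y], of \<sigma>] \<sigma> by simp
qed

text \<open>If the images of two sections agree on \<open>W\<close>, then so do the sections,
  because \<open>u\<close> is injective in each fibre.\<close>

lemma pulled_coprojection_inj:
  assumes "u \<in> coprojections (Fam X) C"
  shows "inj_on (On_arr pulled_ultraproduct u) (On_obj pulled_ultraproduct (src u))"
proof (rule inj_onI)
  note u = coprojection_arr[OF assms]
  fix c d assume c: "c \<in> On_obj pulled_ultraproduct (src u)" and d: "d \<in> On_obj pulled_ultraproduct (src u)"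
    and eq: "On_arr pulled_ultraproduct u c = On_arr pulled_ultraproduct u d"
  obtain \<sigma> where \<sigma>: "\<sigma> \<in> partial_sections \<U> (pulled (src u))" "c = section_eq \<U> (pulled (src u)) `` {\<sigma>}"
    using c by (rule pulled_classE)
  obtain \<tau> where \<tau>: "\<tau> \<in> partial_sections \<U> (pulled (src u))" "d = section_eq \<U> (pulled (src u)) `` {\<tau>}"
    using d by (rule pulled_classE)
  have "(\<lambda>t. map_option (act u (p t)) (\<sigma> t), \<lambda>t. map_option (act u (p t)) (\<tau> t)) \<in> section_eq \<U> (pulled (tgt u))"
    using eq \<sigma> \<tau> section_class_eq_iff[OF U pulled_post[OF u \<sigma>(1)] pulled_post[OF u \<tau>(1)]]
    by (simp add: pulled_arr[OF u])
  then obtain W where W: "W \<in> \<U>" "\<And>t. t \<in> W \<Longrightarrow> \<exists>y. map_option (act u (p t)) (\<sigma> t) = Some y \<and>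
      map_option (act u (p t)) (\<tau> t) = Some y"
    by (elim section_eqE) blast
  have "(\<sigma>, \<tau>) \<in> section_eq \<U> (pulled (src u))"
  proof (rule section_eqI[OF \<sigma>(1) \<tau>(1) W(1)])
    fix t assume "t \<in> W"
    then obtain a b where ab: "\<sigma> t = Some a" "\<tau> t = Some b" "act u (p t) a = act u (p t) b"
      using W(2)[of t] by auto
    then have "a = b"
      using coprojection_inj[OF assms, of a "p t" b] \<sigma>(1) \<tau>(1) by (auto simp: pulled_sections_iff)
    then show "\<exists>y. \<sigma> t = Some y \<and> \<tau> t = Some y"
      using ab by simp
  qed
  then show "c = d"
    using section_class_eq_iff[OF U \<sigma>(1) \<tau>(1)] \<sigma> \<tau> by simp
qed

text \<open>Restricting a section to a set of the ultrafilter does not change its class. On the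
  given set its values come from \<open>u\<close>, and choosing preimages there yields a section of
  the smaller family.\<close>

lemma pulled_coprojection_image:
  assumes "u \<in> coprojections (Fam X) C" and \<sigma>: "\<sigma> \<in> partial_sections \<U> (pulled C)"
    and D: "{t. \<exists>a\<in>src u (p t). \<sigma> t = Some (act u (p t) a)} \<in> \<U>" (is "?D \<in> \<U>")
  shows "section_eq \<U> (pulled C) `` {\<sigma>} \<in> On_arr pulled_ultraproduct u ` On_obj pulled_ultraproduct (src u)"
proof -
  note u = coprojection_arr[OF assms(1)] and ut = coprojection_tgt[OF assms(1)]
  have "\<forall>t\<in>?D. \<exists>a. a \<in> src u (p t) \<and> \<sigma> t = Some (act u (p t) a)"
    by blast
  then obtain a where a: "\<And>t. t \<in> ?D \<Longrightarrow> a t \<in> src u (p t) \<and> \<sigma> t = Some (act u (p t) (a t))"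
    by (drule_tac bchoice) blast
  define \<tau> where "\<tau> t = (if t \<in> ?D then Some (a t) else None)" for t
  have "dom \<tau> = ?D"
    by (auto simp: \<tau>_def split: if_splits)
  moreover have "y \<in> src u (p t)" if "\<tau> t = Some y" for t y
    using that a[of t] unfolding \<tau>_def by (simp only: option.inject option.distinct split: if_splits)
  ultimately have \<tau>: "\<tau> \<in> partial_sections \<U> (pulled (src u))"
    unfolding pulled_sections_iff using D by (simp only:) blast
  have "(\<sigma>, \<lambda>t. map_option (act u (p t)) (\<tau> t)) \<in> section_eq \<U> (pulled C)"
  proof (rule section_eqI[OF \<sigma> _ D])
    show "(\<lambda>t. map_option (act u (p t)) (\<tau> t)) \<in> partial_sections \<U> (pulled C)"
      using pulled_post[OF u \<tau>] ut by simp
    show "\<exists>y. \<sigma> t = Some y \<and> map_option (act u (p t)) (\<tau> t) = Some y" if "t \<in> ?D" for t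
      unfolding \<tau>_def using a[OF that] that by (simp only: if_True option.map) blast
  qed
  from equiv_class_eq[OF equiv_section_eq[OF U] this]
  have "section_eq \<U> (pulled C) `` {\<sigma>} = On_arr pulled_ultraproduct u (section_eq \<U> (pulled (src u)) `` {\<tau>})"
    using pulled_arr[OF u \<tau>] by (simp only: ut)
  then show ?thesis
    using pulled_classI[OF \<tau>] by blast
qed

lemma pulled_FC_object:
  "FC_object (Fam X :: (('x, 'u::infinite) family, _) cat) pulled_ultraproduct"
  unfolding FC_object_def preserves_finite_coproducts_def Fam_Dom Fam_Cod
proof (intro conjI allI impI pulled_is_set_functor)
  fix z :: "('x, 'u) family"
  assume "is_initial (Fam X) z"
  then have "z x = {}" for x
    by (rule initial_empty)
  \<comment> \<open>Over empty fibres only the nowhere defined section is left, and its domain is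
    not in \<open>\<U>\<close>.\<close>
  then have "partial_sections \<U> (pulled z) = {}"
    using ultrafilter_empty[OF U] by (auto simp: pulled_sections_iff dom_def)
  then show "On_obj pulled_ultraproduct z = {}"
    by (simp add: pulled_obj)
next
  fix i j :: "('x, 'u) family_map"
  assume cp: "is_coproduct (Fam X) i j"
  have i: "i \<in> coprojections (Fam X) (tgt i)" and j: "j \<in> coprojections (Fam X) (tgt i)"
    and disj: "\<And>x. act i x ` src i x \<inter> act j x ` src j x = {}"
    and un: "\<And>x. tgt i x = act i x ` src i x \<union> act j x ` src j x"
    using cp by (auto simp: coprojections_iff Fam_coproduct_iff)
  note ia = coprojection_arr[OF i] and ja = coprojection_arr[OF j]
  have tgts: "tgt j = tgt i"
    using coprojection_tgt[OF j] .
  \<comment> \<open>A common class would provide a set of the ultrafilter, hence a point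
    \<open>t\<close>, at which a value of \<open>i\<close> equals a value of
    \<open>j\<close>.\<close>
  have mixed: "On_arr pulled_ultraproduct i c \<noteq> On_arr pulled_ultraproduct j d"
    if c: "c \<in> On_obj pulled_ultraproduct (src i)" and d: "d \<in> On_obj pulled_ultraproduct (src j)" for c d
  proof
    assume eq: "On_arr pulled_ultraproduct i c = On_arr pulled_ultraproduct j d"
    obtain \<sigma> where \<sigma>: "\<sigma> \<in> partial_sections \<U> (pulled (src i))" "c = section_eq \<U> (pulled (src i)) `` {\<sigma>}"
      using c by (rule pulled_classE)
    obtain \<tau> where \<tau>: "\<tau> \<in> partial_sections \<U> (pulled (src j))" "d = section_eq \<U> (pulled (src j)) `` {\<tau>}"
      using d by (rule pulled_classE)
    have "(\<lambda>t. map_option (act i (p t)) (\<sigma> t), \<lambda>t. map_option (act j (p t)) (\<tau> t)) \<in> section_eq \<U> (pulled (tgt i))"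
      using eq \<sigma> \<tau> section_class_eq_iff[OF U pulled_post[OF ia \<sigma>(1)], of "\<lambda>t. map_option (act j (p t)) (\<tau> t)"]
        pulled_post[OF ja \<tau>(1)] tgts
      by (simp add: pulled_arr ia ja)
    then obtain W where W: "W \<in> \<U>" "\<And>t. t \<in> W \<Longrightarrow> \<exists>y. map_option (act i (p t)) (\<sigma> t) = Some y \<and>
        map_option (act j (p t)) (\<tau> t) = Some y"
      by (elim section_eqE) blast
    obtain t where "t \<in> W"
      using W(1) ultrafilter_empty[OF U] by (cases "W = {}") auto
    then obtain a b where "\<sigma> t = Some a" "\<tau> t = Some b" "act i (p t) a = act j (p t) b"
      using W(2)[of t] by auto
    then show False
      using disj[of "p t"] \<sigma>(1) \<tau>(1) by (fastforce simp: pulled_sections_iff)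
  qed
  show "bij_betw (case_sum (On_arr pulled_ultraproduct i) (On_arr pulled_ultraproduct j))
      (On_obj pulled_ultraproduct (src i) <+> On_obj pulled_ultraproduct (src j))
      (On_obj pulled_ultraproduct (tgt i))"
  proof (rule bij_betw_case_sum[OF pulled_coprojection_inj[OF i] pulled_coprojection_inj[OF j] mixed])
    show "On_arr pulled_ultraproduct i ` On_obj pulled_ultraproduct (src i) \<union>
        On_arr pulled_ultraproduct j ` On_obj pulled_ultraproduct (src j) = On_obj pulled_ultraproduct (tgt i)"
    proof (intro equalityI Un_least image_subsetI subsetI)
      fix c
      show "On_arr pulled_ultraproduct i c \<in> On_obj pulled_ultraproduct (tgt i)"
        if "c \<in> On_obj pulled_ultraproduct (src i)"
        by (rule pulled_arr_in[OF ia that])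
      show "On_arr pulled_ultraproduct j c \<in> On_obj pulled_ultraproduct (tgt i)"
        if "c \<in> On_obj pulled_ultraproduct (src j)"
        using pulled_arr_in[OF ja that] by (simp only: tgts)
      assume "c \<in> On_obj pulled_ultraproduct (tgt i)"
      then obtain \<sigma> where \<sigma>: "\<sigma> \<in> partial_sections \<U> (pulled (tgt i))"
          "c = section_eq \<U> (pulled (tgt i)) `` {\<sigma>}"
        by (rule pulled_classE)
      \<comment> \<open>The coprojection that hits the value of \<open>\<sigma>\<close> splits
        \<open>dom \<sigma>\<close> into two pieces. One of them belongs to the ultrafilter, and the
        class of \<open>\<sigma>\<close> comes from that side.\<close>
      have "t \<in> dom \<sigma> \<longleftrightarrow> (\<exists>a\<in>src i (p t). \<sigma> t = Some (act i (p t) a)) \<or>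
          (\<exists>a\<in>src j (p t). \<sigma> t = Some (act j (p t) a))" for t
      proof
        assume "t \<in> dom \<sigma>"
        then obtain y where y: "\<sigma> t = Some y" by blast
        then have "y \<in> tgt i (p t)"
          using \<sigma>(1) by (auto simp: pulled_sections_iff)
        then have "y \<in> act i (p t) ` src i (p t) \<union> act j (p t) ` src j (p t)"
          by (simp only: un)
        with y show "(\<exists>a\<in>src i (p t). \<sigma> t = Some (act i (p t) a)) \<or>
            (\<exists>a\<in>src j (p t). \<sigma> t = Some (act j (p t) a))"
          by auto
      qed auto
      then have "dom \<sigma> = {t. \<exists>a\<in>src i (p t). \<sigma> t = Some (act i (p t) a)} \<union>
          {t. \<exists>a\<in>src j (p t). \<sigma> t = Some (act j (p t) a)}"
        by blast
      moreover have "dom \<sigma> \<in> \<U>"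
        using \<sigma>(1) by (simp add: pulled_sections_iff)
      ultimately have "{t. \<exists>a\<in>src i (p t). \<sigma> t = Some (act i (p t) a)} \<in> \<U> \<or>
          {t. \<exists>a\<in>src j (p t). \<sigma> t = Some (act j (p t) a)} \<in> \<U>"
        using ultrafilter_Un[OF U] by simp
      then show "c \<in> On_arr pulled_ultraproduct i ` On_obj pulled_ultraproduct (src i) \<union>
          On_arr pulled_ultraproduct j ` On_obj pulled_ultraproduct (src j)"
        unfolding \<sigma>(2) using pulled_coprojection_image[OF i \<sigma>(1)] pulled_coprojection_image[OF j \<sigma>(1)]
        by (elim disjE) (simp_all only: Un_iff simp_thms)
    qed
  qed
qed

end

section \<open>Transport along natural isomorphisms\<close>

lemma bij_betw_map_sum:
  assumes f: "bij_betw f A C" and g: "bij_betw g B D"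
  shows "bij_betw (map_sum f g) (A <+> B) (C <+> D)"
proof (rule bij_betw_byWitness[where f' = "map_sum (inv_into A f) (inv_into B g)"])
  show "\<forall>s\<in>A <+> B. map_sum (inv_into A f) (inv_into B g) (map_sum f g s) = s"
    using bij_betw_inv_into_left[OF f] bij_betw_inv_into_left[OF g] by auto
  show "\<forall>s\<in>C <+> D. map_sum f g (map_sum (inv_into A f) (inv_into B g) s) = s"
    using bij_betw_inv_into_right[OF f] bij_betw_inv_into_right[OF g] by auto
  show "map_sum f g ` (A <+> B) \<subseteq> C <+> D"
    using bij_betw_apply[OF f] bij_betw_apply[OF g] by auto
  show "map_sum (inv_into A f) (inv_into B g) ` (C <+> D) \<subseteq> A <+> B"
    using bij_betw_apply[OF bij_betw_inv_into[OF f]] bij_betw_apply[OF bij_betw_inv_into[OF g]] by auto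
qed

text \<open>Each element of a value of \<open>G\<close> is \<open>\<eta>\<close> of an element of
  \<open>F\<close>, so naturality translates the functor laws as well as the coproduct bijections
  from \<open>F\<close> to \<open>G\<close>. With \<open>G\<close> the integral of a representable,
  this yields its functoriality along with its preservation of coproducts.\<close>

lemma natural_iso_FC_object:
  fixes X :: "'x set" and F :: "(('x, 'u::infinite) family, ('x, 'u) family_map, 'v) set_functor"
  assumes "FC_object (Fam X) F" and iso: "natural_iso (Fam X) F G \<eta>"
  shows "FC_object (Fam X) G"
proof -
  have F: "is_set_functor (Fam X) F" "preserves_finite_coproducts (Fam X) F"
    using assms by (auto simp: FC_object_def)
  have bij: "bij_betw (\<eta> c) (On_obj F c) (On_obj G c)" if "c \<in> families X" for c
    using iso that by (auto simp: natural_iso_def)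
  have nat: "On_arr G f (\<eta> (src f) t) = \<eta> (tgt f) (On_arr F f t)"
    if "f \<in> Arr (Fam X)" "t \<in> On_obj F (src f)" for f t
    using iso that by (auto simp: natural_iso_def)
  have Fin: "On_arr F f t \<in> On_obj F (tgt f)" if "f \<in> Arr (Fam X)" "t \<in> On_obj F (src f)" for f t
    using F(1) that by (auto simp: is_set_functor_def)
  have ex: "\<exists>t\<in>On_obj F c. s = \<eta> c t" if "c \<in> families X" "s \<in> On_obj G c" for c s
    using bij[OF that(1)] that(2) by (auto simp: bij_betw_def)
  have "is_set_functor (Fam X) G"
    unfolding is_set_functor_def Fam_Dom Fam_Cod Fam_Obj
  proof (intro conjI ballI impI funcsetI)
    fix f s assume f: "f \<in> Arr (Fam X)" and s: "s \<in> On_obj G (src f)"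
    then obtain t where t: "t \<in> On_obj F (src f)" "s = \<eta> (src f) t"
      using ex[OF src_families] by blast
    show "On_arr G f s \<in> On_obj G (tgt f)"
      using nat[OF f t(1)] t(2) Fin[OF f t(1)] bij[OF tgt_families[OF f]] by (auto simp: bij_betw_def)
    fix g assume g: "g \<in> Arr (Fam X)" and fg: "tgt f = src g"
    have "On_arr F (Comp (Fam X) g f) t = On_arr F g (On_arr F f t)"
      using F(1) f g fg t by (auto simp: is_set_functor_def)
    then show "On_arr G (Comp (Fam X) g f) s = On_arr G g (On_arr G f s)"
      using nat[OF Fam_Comp_in[OF f g fg[symmetric]], of t] nat[OF f t(1)] nat[OF g, of "On_arr F f t"] Fin[OF f t(1)]
      by (simp add: t fg)
  next
    fix c s assume c: "c \<in> families X" and s: "s \<in> On_obj G c"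
    then obtain t where t: "t \<in> On_obj F c" "s = \<eta> c t"
      using ex by blast
    then show "On_arr G (Ident (Fam X) c) s = s"
      using nat[OF Fam_Ident_in[OF c], of t] F(1) c by (simp add: is_set_functor_def)
  qed
  moreover have "preserves_finite_coproducts (Fam X) G"
    unfolding preserves_finite_coproducts_def Fam_Dom Fam_Cod
  proof (intro conjI allI impI)
    fix z :: "('x, 'u) family"
    assume z: "is_initial (Fam X) z"
    then have "On_obj F z = {}" "z \<in> families X"
      using F(2) by (auto simp: preserves_finite_coproducts_def is_initial_def)
    then show "On_obj G z = {}"
      using bij by (fastforce simp: bij_betw_def)
  next
    fix i j :: "('x, 'u) family_map"
    assume ij: "is_coproduct (Fam X) i j"
    then have i: "i \<in> Arr (Fam X)" and j: "j \<in> Arr (Fam X)" and t: "tgt j = tgt i"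
      by (auto simp: is_coproduct_def)
    have "bij_betw (case_sum (On_arr F i) (On_arr F j))
        (On_obj F (src i) <+> On_obj F (src j)) (On_obj F (tgt i))"
      using F(2) ij by (auto simp: preserves_finite_coproducts_def)
    from bij_betw_trans[OF this bij[OF tgt_families[OF i]]]
    have 1: "bij_betw (\<eta> (tgt i) \<circ> case_sum (On_arr F i) (On_arr F j))
        (On_obj F (src i) <+> On_obj F (src j)) (On_obj G (tgt i))" .
    have 2: "bij_betw (map_sum (\<eta> (src i)) (\<eta> (src j)))
        (On_obj F (src i) <+> On_obj F (src j)) (On_obj G (src i) <+> On_obj G (src j))"
      by (rule bij_betw_map_sum[OF bij[OF src_families[OF i]] bij[OF src_families[OF j]]])
    \<comment> \<open>By naturality this composite is \<open>\<eta>\<close> after the coproduct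
      bijection of \<open>F\<close>; the bijection \<open>map_sum\<close> on the right is then
      cancelled.\<close>
    have "bij_betw (case_sum (On_arr G i) (On_arr G j) \<circ> map_sum (\<eta> (src i)) (\<eta> (src j)))
        (On_obj F (src i) <+> On_obj F (src j)) (On_obj G (tgt i))"
    proof (rule bij_betw_cong[THEN iffD1, OF _ 1])
      fix s assume "s \<in> On_obj F (src i) <+> On_obj F (src j)"
      then show "(\<eta> (tgt i) \<circ> case_sum (On_arr F i) (On_arr F j)) s =
          (case_sum (On_arr G i) (On_arr G j) \<circ> map_sum (\<eta> (src i)) (\<eta> (src j))) s"
        by (elim PlusE) (simp_all add: nat[OF i] nat[OF j] t)
    qed
    then show "bij_betw (case_sum (On_arr G i) (On_arr G j))
        (On_obj G (src i) <+> On_obj G (src j)) (On_obj G (tgt i))"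
      using bij_betw_comp_iff[OF 2] by blast
  qed
  ultimately show ?thesis
    by (simp add: FC_object_def)
qed

lemma natural_iso_inverse:
  assumes "is_set_functor C F" "natural_iso C F G \<eta>"
    and "\<And>f. f \<in> Arr C \<Longrightarrow> Dom C f \<in> Obj C \<and> Cod C f \<in> Obj C"
  shows "natural_iso C G F (\<lambda>c. inv_into (On_obj F c) (\<eta> c))"
proof -
  have bij: "bij_betw (\<eta> c) (On_obj F c) (On_obj G c)" if "c \<in> Obj C" for c
    using assms(2) that by (auto simp: natural_iso_def)
  have "inv_into (On_obj F (Cod C f)) (\<eta> (Cod C f)) (On_arr G f t) =
      On_arr F f (inv_into (On_obj F (Dom C f)) (\<eta> (Dom C f)) t)"
    if f: "f \<in> Arr C" and t: "t \<in> On_obj G (Dom C f)" for f t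
  proof -
    have b: "bij_betw (\<eta> (Dom C f)) (On_obj F (Dom C f)) (On_obj G (Dom C f))"
      "bij_betw (\<eta> (Cod C f)) (On_obj F (Cod C f)) (On_obj G (Cod C f))"
      using bij assms(3)[OF f] by auto
    obtain s where s: "s \<in> On_obj F (Dom C f)" "t = \<eta> (Dom C f) s"
      using t b(1) by (auto simp: bij_betw_def)
    have "On_arr G f t = \<eta> (Cod C f) (On_arr F f s)"
      using assms(2) f s by (simp add: natural_iso_def)
    moreover have "On_arr F f s \<in> On_obj F (Cod C f)"
      using assms(1) f s by (auto simp: is_set_functor_def)
    ultimately show ?thesis
      using s b by (simp add: bij_betw_inv_into_left)
  qed
  then show ?thesis
    using bij_betw_inv_into[OF bij] by (auto simp: natural_iso_def)
qed

lemma natural_iso_trans: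
  assumes "is_set_functor C F" "natural_iso C F G \<eta>" "natural_iso C G H \<theta>"
    and "\<And>f. f \<in> Arr C \<Longrightarrow> Dom C f \<in> Obj C"
  shows "natural_iso C F H (\<lambda>c. \<theta> c \<circ> \<eta> c)"
  unfolding natural_iso_def
proof (intro conjI ballI)
  show "bij_betw (\<theta> c \<circ> \<eta> c) (On_obj F c) (On_obj H c)" if "c \<in> Obj C" for c
    using assms(2,3) that by (auto simp: natural_iso_def intro: bij_betw_trans)
  fix f t assume f: "f \<in> Arr C" and t: "t \<in> On_obj F (Dom C f)"
  have "\<eta> (Dom C f) t \<in> On_obj G (Dom C f)"
    using assms(2) assms(4)[OF f] t by (auto simp: natural_iso_def bij_betw_def)
  then show "(\<theta> (Cod C f) \<circ> \<eta> (Cod C f)) (On_arr F f t) = On_arr H f ((\<theta> (Dom C f) \<circ> \<eta> (Dom C f)) t)"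
    using assms(2,3) f t by (simp add: natural_iso_def)
qed

text \<open>The comparison map runs from the ultraproduct, the side where the laws are proved, while
  the theorem names the integral first.\<close>

lemma FC_isomorphic_sym:
  assumes "FC_object (Fam X) F" "natural_iso (Fam X) F G \<eta>"
  shows "FC_isomorphic (Fam X) G F"
proof -
  have "is_set_functor (Fam X) F"
    using assms by (simp add: FC_object_def)
  from natural_iso_inverse[OF this assms(2)]
  have "\<exists>\<theta>. natural_iso (Fam X) G F \<theta>"
    unfolding Fam_Dom Fam_Cod Fam_Obj by (blast intro: src_families tgt_families)
  then show ?thesis
    using assms natural_iso_FC_object by (auto simp: FC_isomorphic_def)
qed

lemma FC_isomorphic_trans:
  assumes "FC_isomorphic (Fam X) F G" "FC_isomorphic (Fam X) G H"
  shows "FC_isomorphic (Fam X) F H"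
proof -
  obtain \<eta> \<theta> where "natural_iso (Fam X) F G \<eta>" "natural_iso (Fam X) G H \<theta>" "is_set_functor (Fam X) F"
    using assms by (auto simp: FC_isomorphic_def FC_object_def)
  then have "\<exists>\<theta>. natural_iso (Fam X) F H \<theta>"
    using natural_iso_trans[of "Fam X" F G \<eta> H \<theta>] unfolding Fam_Dom Fam_Cod Fam_Obj
    by (blast intro: src_families)
  then show ?thesis
    using assms by (simp add: FC_isomorphic_def)
qed

section \<open>Germs of partial maps as classes of partial sections\<close>

lemma Summands_object_ultrafilter: "object_ultrafilter X C V \<subseteq> Summands (Fam X) C"
  by (auto simp: object_ultrafilter_def)

lemma sub_class_in_Summands:
  "C \<in> families X \<Longrightarrow> W \<subseteq> Sigma X C \<Longrightarrow> sub_class X C W \<in> Summands (Fam X) C"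
  by (auto simp: Summands_eq)

text \<open>All members of \<open>sub_class X C W\<close> have the image \<open>W\<close>, and the
  inclusion of \<open>W\<close> is one of them, so the existential quantifier in
  \<open>object_ultrafilter\<close> has only one image to test.\<close>

lemma sub_class_in_object_ultrafilter:
  assumes C: "C \<in> families X" and W: "W \<subseteq> Sigma X C"
  shows "sub_class X C W \<in> object_ultrafilter X C V \<longleftrightarrow> W \<in> V"
  using sub_class_nonempty[OF C W] sub_class_in_Summands[OF C W] total_image_inclusion[OF C W]
  by (auto simp: object_ultrafilter_def sub_class_def)

text \<open>Once summands are written as \<open>sub_class X C W\<close>, each clause of
  \<open>beta\<close> is the corresponding clause for sets: the order is inclusion, a common lower
  bound is given by the intersection, and complements are complements in \<open>X.C\<close>.\<close>

lemma object_ultrafilter_beta: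
  assumes C: "C \<in> families X" and V: "ultrafilter_on (Sigma X C) V"
  shows "object_ultrafilter X C V \<in> beta (Fam X) C"
proof -
  let ?O = "object_ultrafilter X C V"
  have rep: "\<exists>W\<subseteq>Sigma X C. S = sub_class X C W" if "S \<in> Summands (Fam X) C" for S
    using that by (auto simp: Summands_eq[OF C])
  have sub: "\<exists>W\<subseteq>Sigma X C. S = sub_class X C W \<and> W \<in> V" if S: "S \<in> ?O" for S
  proof -
    obtain W where W: "W \<subseteq> Sigma X C" "S = sub_class X C W"
      using rep[OF subsetD[OF Summands_object_ultrafilter S]] by (elim exE conjE)
    then show ?thesis
      using S sub_class_in_object_ultrafilter[OF C W(1)] by (intro exI[of _ W]) simp
  qed
  have ne: "?O \<noteq> {}"
    using sub_class_in_object_ultrafilter[OF C order_refl, of V] ultrafilter_top[OF V] by fastforce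
  have up: "T \<in> ?O" if S: "S \<in> ?O" and T: "T \<in> Summands (Fam X) C" and le: "summand_le (Fam X) S T" for S T
  proof -
    obtain W where W: "W \<subseteq> Sigma X C" "S = sub_class X C W" "W \<in> V"
      using sub[OF S] by (elim exE conjE)
    obtain W' where W': "W' \<subseteq> Sigma X C" "T = sub_class X C W'"
      using rep[OF T] by (elim exE conjE)
    have "W \<subseteq> W'"
      using le summand_le_iff[OF C W(1) W'(1)] W(2) W'(2) by simp
    then show ?thesis
      using ultrafilter_mono[OF V W(3) _ W'(1)] sub_class_in_object_ultrafilter[OF C W'(1)] W'(2) by simp
  qed
  have dir: "\<exists>R\<in>?O. summand_le (Fam X) R S \<and> summand_le (Fam X) R T"
    if S: "S \<in> ?O" and T: "T \<in> ?O" for S T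
  proof -
    obtain W where W: "W \<subseteq> Sigma X C" "S = sub_class X C W" "W \<in> V"
      using sub[OF S] by (elim exE conjE)
    obtain W' where W': "W' \<subseteq> Sigma X C" "T = sub_class X C W'" "W' \<in> V"
      using sub[OF T] by (elim exE conjE)
    have I: "W \<inter> W' \<subseteq> Sigma X C"
      using W(1) by blast
    have "sub_class X C (W \<inter> W') \<in> ?O"
      using sub_class_in_object_ultrafilter[OF C I] ultrafilter_Int[OF V W(3) W'(3)] by simp
    then show ?thesis
      using summand_le_iff[OF C I W(1)] summand_le_iff[OF C I W'(1)]
      unfolding W(2) W'(2) by (intro bexI) simp_all
  qed
  have compl: "S \<in> ?O \<longleftrightarrow> T \<notin> ?O"
    if S: "S \<in> Summands (Fam X) C" and T: "T \<in> Summands (Fam X) C"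
      and c: "summand_complement (Fam X) S T" for S T
  proof -
    obtain W where W: "W \<subseteq> Sigma X C" "S = sub_class X C W"
      using rep[OF S] by (elim exE conjE)
    obtain W' where W': "W' \<subseteq> Sigma X C" "T = sub_class X C W'"
      using rep[OF T] by (elim exE conjE)
    have "W' = Sigma X C - W"
      using c summand_complement_iff[OF C W(1) W'(1)] W(2) W'(2) by simp
    then show ?thesis
      using sub_class_in_object_ultrafilter[OF C W(1)] sub_class_in_object_ultrafilter[OF C W'(1)]
        ultrafilter_Diff[OF V W(1)] W(2) W'(2) by simp
  qed
  show ?thesis
    unfolding beta_def
    by (intro CollectI conjI ballI impI Summands_object_ultrafilter ne; (rule up dir compl)?; assumption)
qed

lemma subset_Summands_eqI:
  assumes C: "C \<in> families X" and "V \<subseteq> Summands (Fam X) C" "V' \<subseteq> Summands (Fam X) C"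
    and "\<And>W. W \<subseteq> Sigma X C \<Longrightarrow> sub_class X C W \<in> V \<longleftrightarrow> sub_class X C W \<in> V'"
  shows "V = V'"
  using assms(2-4) unfolding Summands_eq[OF C] by blast

text \<open>A pullback of a coprojection is recognised by its image alone. Hence every coprojection
  whose image is the preimage of \<open>W\<close> is a pullback of the inclusion of
  \<open>W\<close>, its second leg being obtained by factoring.\<close>

lemma inverse_image_sub_class:
  assumes f: "f \<in> Arr (Fam X)" and W: "W \<subseteq> Sigma X (tgt f)"
  shows "inverse_image (Fam X) f (sub_class X (tgt f) W) =
    sub_class X (src f) {(x, a). a \<in> src f x \<and> (x, act f x a) \<in> W}"
proof (intro set_eqI iffI)
  fix p assume "p \<in> inverse_image (Fam X) f (sub_class X (tgt f) W)"
  then obtain v q where v: "v \<in> coprojections (Fam X) (tgt f)" "total_image X v = W"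
    and pb: "is_pullback (Fam X) f v p q"
    by (auto simp: inverse_image_def sub_class_def)
  from pb have p: "p \<in> coprojections (Fam X) (src f)" and q: "q \<in> Arr (Fam X)" "src p = src q" "tgt q = src v"
    and eq: "Comp (Fam X) f p = Comp (Fam X) v q"
    and im: "\<And>x a. a \<in> src f x \<Longrightarrow> (x, act f x a) \<in> W \<Longrightarrow> (x, a) \<in> total_image X p"
    unfolding Fam_pullback_iff[OF f v(1)] v(2) by blast+
  note pa = coprojection_arr[OF p]
  have "a \<in> src f x \<and> (x, act f x a) \<in> W" if "(x, a) \<in> total_image X p" for x a
  proof -
    obtain b where b: "b \<in> src p x" "act p x b = a"
      using \<open>(x, a) \<in> _\<close> by (auto simp: in_total_image[OF pa])
    have "act f x a = act v x (act q x b)" "act q x b \<in> src v x"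
      using act_Comp_eqD[OF eq, of b x] act_in[OF q(1), of b x] b q by auto
    then have "(x, act f x a) \<in> W"
      unfolding v(2)[symmetric] in_total_image[OF coprojection_arr[OF v(1)]] by auto
    then show ?thesis
      using act_in[OF pa b(1)] coprojection_tgt[OF p] b(2) by simp
  qed
  then have "total_image X p = {(x, a). a \<in> src f x \<and> (x, act f x a) \<in> W}"
    using im by auto
  then show "p \<in> sub_class X (src f) {(x, a). a \<in> src f x \<and> (x, act f x a) \<in> W}"
    using p by (simp add: sub_class_def)
next
  fix p assume "p \<in> sub_class X (src f) {(x, a). a \<in> src f x \<and> (x, act f x a) \<in> W}"
  then have p: "p \<in> coprojections (Fam X) (src f)"
    and im: "total_image X p = {(x, a). a \<in> src f x \<and> (x, act f x a) \<in> W}"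
    by (auto simp: sub_class_def)
  note pa = coprojection_arr[OF p] and pt = coprojection_tgt[OF p]
  have t: "tgt f \<in> families X"
    using f by (rule tgt_families)
  let ?v = "inclusion (tgt f) W"
  have v: "?v \<in> coprojections (Fam X) (tgt f)" and iv: "total_image X ?v = W"
    using t W by (auto simp: inclusion_coprojection total_image_inclusion)
  have fp: "Comp (Fam X) f p \<in> Arr (Fam X)"
    using Fam_Comp_in[OF pa f] pt by simp
  have "(x, act f x (act p x b)) \<in> W" if "b \<in> src p x" for x b
  proof -
    have "(x, act p x b) \<in> total_image X p"
      using that in_total_image[OF pa] by blast
    then show ?thesis
      by (simp add: im)
  qed
  then have imsub: "total_image X (Comp (Fam X) f p) \<subseteq> total_image X ?v"
    unfolding iv using in_total_image[OF fp] by auto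
  obtain q where q: "q \<in> Arr (Fam X)" "src q = src p" "tgt q = src ?v"
      "Comp (Fam X) ?v q = Comp (Fam X) f p"
    by (rule factor_through[OF v fp _ imsub]) simp_all
  have "is_pullback (Fam X) f ?v p q"
    unfolding Fam_pullback_iff[OF f v] iv im using p q by auto
  then show "p \<in> inverse_image (Fam X) f (sub_class X (tgt f) W)"
    using sub_class_nonempty[OF t W] by (auto simp: inverse_image_def)
qed

lemma Comp_coprojection:
  assumes u: "u \<in> coprojections (Fam X) C" and p: "p \<in> coprojections (Fam X) (src u)"
  shows "Comp (Fam X) u p \<in> coprojections (Fam X) C"
  unfolding coprojections_iff
proof (intro conjI allI inj_onI)
  note ua = coprojection_arr[OF u] and pa = coprojection_arr[OF p] and pt = coprojection_tgt[OF p]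
  show "Comp (Fam X) u p \<in> Arr (Fam X)"
    using Fam_Comp_in[OF pa ua] pt by simp
  show "tgt (Comp (Fam X) u p) = C"
    using coprojection_tgt[OF u] by simp
  fix x a b
  assume "a \<in> src (Comp (Fam X) u p) x" "b \<in> src (Comp (Fam X) u p) x"
    "act (Comp (Fam X) u p) x a = act (Comp (Fam X) u p) x b"
  then have ab: "a \<in> src p x" "b \<in> src p x" "act u x (act p x a) = act u x (act p x b)"
    by auto
  then have "act p x a = act p x b"
    using coprojection_inj[OF u, of "act p x a" x "act p x b"] act_in[OF pa, of _ x] pt by simp
  then show "a = b"
    using coprojection_inj[OF p] ab by blast
qed

text \<open>To reach the whole class on the right, a coprojection whose image is the direct image of
  \<open>W\<close> is factored through \<open>u\<close>; injectivity of \<open>u\<close> makes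
  \<open>W\<close> the image of the factor. This turns the composite in
  \<open>continuous_map\<close> into a set.\<close>

lemma Comp_image_sub_class:
  assumes u: "u \<in> coprojections (Fam X) C" and W: "W \<subseteq> Sigma X (src u)"
  shows "Comp (Fam X) u ` sub_class X (src u) W =
    sub_class X C {(x, y). \<exists>a. (x, a) \<in> W \<and> act u x a = y}"
proof (intro set_eqI iffI)
  fix w assume "w \<in> Comp (Fam X) u ` sub_class X (src u) W"
  then obtain p where p: "p \<in> coprojections (Fam X) (src u)" "total_image X p = W" "w = Comp (Fam X) u p"
    by (auto simp: sub_class_def)
  have w: "Comp (Fam X) u p \<in> coprojections (Fam X) C"
    by (rule Comp_coprojection[OF u p(1)])
  have "(x, y) \<in> total_image X (Comp (Fam X) u p) \<longleftrightarrow> (\<exists>a. (x, a) \<in> W \<and> act u x a = y)" for x y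
    unfolding in_total_image[OF coprojection_arr[OF w]] p(2)[symmetric]
      in_total_image[OF coprojection_arr[OF p(1)]] by auto
  then have "total_image X (Comp (Fam X) u p) = {(x, y). \<exists>a. (x, a) \<in> W \<and> act u x a = y}"
    by auto
  then show "w \<in> sub_class X C {(x, y). \<exists>a. (x, a) \<in> W \<and> act u x a = y}"
    using w p(3) by (simp add: sub_class_def)
next
  note ua = coprojection_arr[OF u]
  fix w assume "w \<in> sub_class X C {(x, y). \<exists>a. (x, a) \<in> W \<and> act u x a = y}"
  then have w: "w \<in> coprojections (Fam X) C"
    and im: "total_image X w = {(x, y). \<exists>a. (x, a) \<in> W \<and> act u x a = y}"
    by (auto simp: sub_class_def)
  note wa = coprojection_arr[OF w]
  have "total_image X w \<subseteq> total_image X u"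
    using W in_total_image[OF ua] by (auto simp: im)
  then obtain h where h: "h \<in> Arr (Fam X)" "src h = src w" "tgt h = src u" "Comp (Fam X) u h = w"
    by (rule factor_through[OF u wa coprojection_tgt[OF w]])
  have uh: "act u x (act h x b) = act w x b" if "b \<in> src w x" for x b
    using act_Comp_eq[OF h(4)] that h(2) by simp
  have "h \<in> coprojections (Fam X) (src u)"
    unfolding coprojections_iff
  proof (intro conjI allI inj_onI h(1,3))
    fix x a b assume ab: "a \<in> src h x" "b \<in> src h x" "act h x a = act h x b"
    then have "act w x a = act w x b"
      using uh h(2) by metis
    then show "a = b"
      using coprojection_inj[OF w] ab h(2) by metis
  qed
  moreover have "(x, a) \<in> total_image X h \<longleftrightarrow> (x, a) \<in> W" for x a
  proof
    assume "(x, a) \<in> total_image X h"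
    then obtain b where b: "b \<in> src w x" "act h x b = a"
      using in_total_image[OF h(1)] h(2) by auto
    then have "(x, act u x a) \<in> total_image X w"
      using uh[OF b(1)] in_total_image[OF wa] by auto
    then obtain a' where a': "(x, a') \<in> W" "act u x a' = act u x a"
      by (auto simp: im)
    have "a' \<in> src u x" "a \<in> src u x"
      using a' W act_in[OF h(1), of b x] b h(2,3) by auto
    then show "(x, a) \<in> W"
      using coprojection_inj[OF u] a' by metis
  next
    assume a: "(x, a) \<in> W"
    then have "(x, act u x a) \<in> total_image X w"
      by (auto simp: im)
    then obtain b where b: "b \<in> src w x" "act w x b = act u x a"
      using in_total_image[OF wa] by auto
    have "act h x b \<in> src u x" "a \<in> src u x"
      using a W act_in[OF h(1), of b x] b h(2,3) by auto
    then have "act h x b = a"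
      using coprojection_inj[OF u] uh[OF b(1)] b(2) by metis
    then show "(x, a) \<in> total_image X h"
      using in_total_image[OF h(1)] b(1) h(2) by auto
  qed
  ultimately have "h \<in> sub_class X (src u) W"
    by (auto simp: sub_class_def)
  then show "w \<in> Comp (Fam X) u ` sub_class X (src u) W"
    using h(4) by blast
qed

text \<open>For a partial map \<open>(u, f)\<close> this is \<open>f\<close> after the inverse of
  \<open>u\<close>, a partial function on \<open>X.A\<close>. When \<open>u\<close> is a
  coprojection, its injectivity leaves \<open>SOME\<close> no choice.\<close>

definition section_of :: "('x, 'u) family_map \<times> ('x, 'u) family_map \<Rightarrow> ('x \<times> 'u) \<rightharpoonup> 'u" where
  "section_of m t = (if \<exists>a\<in>src (fst m) (fst t). act (fst m) (fst t) a = snd t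
     then Some (act (snd m) (fst t) (SOME a. a \<in> src (fst m) (fst t) \<and> act (fst m) (fst t) a = snd t))
     else None)"

lemma section_of_iff:
  assumes u: "u \<in> coprojections (Fam X) C"
  shows "section_of (u, f) (x, y) = Some z \<longleftrightarrow> (\<exists>a\<in>src u x. act u x a = y \<and> act f x a = z)"
proof (cases "\<exists>a\<in>src u x. act u x a = y")
  case True
  then obtain a where a: "a \<in> src u x" "act u x a = y" by blast
  have b: "b = a" if "b \<in> src u x" "act u x b = y" for b
    using coprojection_inj[OF u that(1) a(1)] that(2) a(2) by simp
  have "(SOME a. a \<in> src u x \<and> act u x a = y) = a"
    by (intro some_equality conjI a) (use b in blast)
  then have "section_of (u, f) (x, y) = Some (act f x a)"
    unfolding section_of_def using True by simp
  then show ?thesis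
    using a b by (metis option.inject)
qed (auto simp: section_of_def)

lemma dom_section_of: "u \<in> Arr (Fam X) \<Longrightarrow> dom (section_of (u, f)) = total_image X u"
  by (auto simp: section_of_def in_total_image dom_def split: if_splits)

text \<open>\<open>integral\<close> feeds an arrow \<open>f\<close> into \<open>UF\<close> as the
  partial map whose domain is given by the identity; this is the section that belongs to it.\<close>

lemma section_of_identity:
  assumes "D \<in> families X"
  shows "section_of (Ident (Fam X) D, f) (x, y) = Some z \<longleftrightarrow> y \<in> D x \<and> act f x y = z"
proof -
  from section_of_iff[OF Ident_coprojection[OF assms]] show ?thesis
    by auto
qed

text \<open>The pullback has one element for each \<open>a\<close> whose value under
  \<open>f\<close> lies in the image of \<open>v\<close>, so composites of partial maps are
  fibrewise composites of partial functions, whichever pullback is taken.\<close>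

lemma section_of_comp:
  assumes u: "u \<in> coprojections (Fam X) C" and f: "f \<in> Arr (Fam X)" "src f = src u"
    and v: "v \<in> coprojections (Fam X) (tgt f)" and g: "src g = src v"
    and pb: "is_pullback (Fam X) f v p q"
  shows "section_of (Comp (Fam X) u p, Comp (Fam X) g q) (x, y) = Some z \<longleftrightarrow>
    (\<exists>w. section_of (u, f) (x, y) = Some w \<and> section_of (v, g) (x, w) = Some z)"
proof -
  from pb have p: "p \<in> coprojections (Fam X) (src f)" and q: "q \<in> Arr (Fam X)" "src p = src q" "tgt q = src v"
    and eq: "Comp (Fam X) f p = Comp (Fam X) v q"
    and im: "\<And>x a. a \<in> src f x \<Longrightarrow> (x, act f x a) \<in> total_image X v \<Longrightarrow> (x, a) \<in> total_image X p"
    unfolding Fam_pullback_iff[OF f(1) v] by blast+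
  note pa = coprojection_arr[OF p] and pt = coprojection_tgt[OF p]
  have p': "p \<in> coprojections (Fam X) (src u)"
    using p f by simp
  have fp: "act f x (act p x b) = act v x (act q x b)" if "b \<in> src p x" for b
    using act_Comp_eqD[OF eq that] by simp
  have "section_of (Comp (Fam X) u p, Comp (Fam X) g q) (x, y) = Some z \<longleftrightarrow>
      (\<exists>b\<in>src p x. act u x (act p x b) = y \<and> act g x (act q x b) = z)"
    unfolding section_of_iff[OF Comp_coprojection[OF u p']] using q by auto
  also have "\<dots> \<longleftrightarrow> (\<exists>a\<in>src u x. act u x a = y \<and> (\<exists>c\<in>src v x. act v x c = act f x a \<and> act g x c = z))"
  proof
    assume "\<exists>b\<in>src p x. act u x (act p x b) = y \<and> act g x (act q x b) = z"
    then obtain b where b: "b \<in> src p x" "act u x (act p x b) = y" "act g x (act q x b) = z"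
      by blast
    have "act p x b \<in> src u x" "act q x b \<in> src v x"
      using act_in[OF pa b(1)] act_in[OF q(1), of b x] b(1) q(2,3) pt f(2) by auto
    then show "\<exists>a\<in>src u x. act u x a = y \<and> (\<exists>c\<in>src v x. act v x c = act f x a \<and> act g x c = z)"
      using b fp[OF b(1)] by metis
  next
    assume "\<exists>a\<in>src u x. act u x a = y \<and> (\<exists>c\<in>src v x. act v x c = act f x a \<and> act g x c = z)"
    then obtain a c where a: "a \<in> src u x" "act u x a = y"
      and c: "c \<in> src v x" "act v x c = act f x a" "act g x c = z"
      by blast
    have "(x, act f x a) \<in> total_image X v"
      using c in_total_image[OF coprojection_arr[OF v]] by auto
    then obtain b where b: "b \<in> src p x" "act p x b = a"
      using im[of a x] a(1) f(2) in_total_image[OF pa] by auto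
    have "act q x b \<in> src v x"
      using act_in[OF q(1), of b x] b(1) q by simp
    then have "act q x b = c"
      using coprojection_inj[OF v] c fp[OF b(1)] b(2) by metis
    then show "\<exists>b\<in>src p x. act u x (act p x b) = y \<and> act g x (act q x b) = z"
      using b a c by blast
  qed
  also have "\<dots> \<longleftrightarrow> (\<exists>w. section_of (u, f) (x, y) = Some w \<and> section_of (v, g) (x, w) = Some z)"
    unfolding section_of_iff[OF u] section_of_iff[OF v] by blast
  finally show ?thesis .
qed

text \<open>The image of \<open>U\<close> under the partial map from \<open>X.A\<close> to
  \<open>X.D\<close> that sends \<open>t\<close> to \<open>(fst t, y)\<close> when
  \<open>\<sigma> t = Some y\<close>.\<close>

definition push_sets ::
  "'x set \<Rightarrow> ('x \<times> 'u) set set \<Rightarrow> ('x, 'u) family \<Rightarrow> (('x \<times> 'u) \<rightharpoonup> 'u) \<Rightarrow> ('x \<times> 'u) set set" where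
  "push_sets X U D \<sigma> = {S. S \<subseteq> Sigma X D \<and> {t. \<exists>y. \<sigma> t = Some y \<and> (fst t, y) \<in> S} \<in> U}"

abbreviation (input) ultra_object where "ultra_object X A U \<equiv> (A, object_ultrafilter X A U)"

abbreviation (input) along :: "'x set \<Rightarrow> ('x, 'u) family \<Rightarrow> ('x, 'u) family \<Rightarrow> ('x \<times> 'u, 'u) family"
  where "along X A \<equiv> On_obj (reindex (Sigma X A) fst)"

text \<open>A germ contains all its representatives, so the preimage of a whole class under
  \<open>section_of\<close> is the corresponding germ; see \<open>germ_eq\<close>.\<close>

definition germ_of_class where
  "germ_of_class X A U D c = {m \<in> partial_maps (Fam X) (ultra_object X A U) D. section_of m \<in> c}"

section \<open>Partial maps out of a fixed ultrafilter\<close>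

context
  fixes X :: "'x set" and A :: "('x, 'u::infinite) family" and U :: "('x \<times> 'u) set set"
  assumes A: "A \<in> families X" and U: "ultrafilter_on (Sigma X A) U"
begin

text \<open>Preimages under a partial map respect intersections, but those of a set and of its
  complement cover only \<open>dom \<sigma>\<close>. As \<open>dom \<sigma>\<close> lies in
  \<open>U\<close>, primeness still puts one of the two preimages into \<open>U\<close>.\<close>

lemma push_sets_ultrafilter:
  assumes D: "D \<in> families X" and \<sigma>: "\<sigma> \<in> partial_sections U (along X A D)"
  shows "ultrafilter_on (Sigma X D) (push_sets X U D \<sigma>)"
proof -
  have d: "dom \<sigma> \<in> U" and val: "\<And>t y. \<sigma> t = Some y \<Longrightarrow> y \<in> D (fst t)"
    using \<sigma> by (auto simp: pulled_sections_iff[OF U])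
  have ds: "dom \<sigma> \<subseteq> Sigma X A"
    by (rule ultrafilter_subset[OF U d])
  define pre where "pre S = {t. \<exists>y. \<sigma> t = Some y \<and> (fst t, y) \<in> S}" for S
  have pre: "S \<in> push_sets X U D \<sigma> \<longleftrightarrow> S \<subseteq> Sigma X D \<and> pre S \<in> U" for S
    by (simp add: push_sets_def pre_def)
  have pd: "pre S \<subseteq> Sigma X A" for S
    using ds by (auto simp: pre_def)
  have all: "pre (Sigma X D) = dom \<sigma>"
    using val index_in[OF D] by (fastforce simp: pre_def)
  have int: "pre (S \<inter> T) = pre S \<inter> pre T" for S T
    by (auto simp: pre_def)
  have un: "pre S \<union> pre (Sigma X D - S) = dom \<sigma>" for S
    using val index_in[OF D] by (fastforce simp: pre_def)
  have mono: "pre S \<subseteq> pre T" if "S \<subseteq> T" for S T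
    using that by (auto simp: pre_def)
  have emp: "pre {} = {}"
    by (simp add: pre_def)
  have cases: "pre S \<in> U \<or> pre (Sigma X D - S) \<in> U" for S
    by (rule ultrafilter_Un[OF U]) (use un d in simp)
  have up: "pre T \<in> U" if "pre S \<in> U" "S \<subseteq> T" for S T
    by (rule ultrafilter_mono[OF U that(1) mono[OF that(2)] pd])
  show ?thesis
    unfolding ultrafilter_on_def
  proof (intro conjI ballI allI impI)
    show "push_sets X U D \<sigma> \<subseteq> Pow (Sigma X D)" "Sigma X D \<in> push_sets X U D \<sigma>"
      using d by (auto simp: pre all)
    show "{} \<notin> push_sets X U D \<sigma>"
      using ultrafilter_empty[OF U] by (simp add: pre emp)
    show "S \<inter> T \<in> push_sets X U D \<sigma>" if "S \<in> push_sets X U D \<sigma>" "T \<in> push_sets X U D \<sigma>" for S T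
      using that ultrafilter_Int[OF U] by (auto simp: pre int)
    show "T \<in> push_sets X U D \<sigma>" if "S \<in> push_sets X U D \<sigma>" "S \<subseteq> T \<and> T \<subseteq> Sigma X D" for S T
      using that up by (auto simp: pre)
    show "S \<in> push_sets X U D \<sigma> \<or> Sigma X D - S \<in> push_sets X U D \<sigma>" if "S \<subseteq> Sigma X D" for S
      using that cases[of S] by (auto simp: pre)
  qed
qed

text \<open>On the set where the sections agree, they have the same preimages; one implication is
  proved for arbitrary sections and used in both directions.\<close>

lemma push_sets_cong:
  assumes "(\<sigma>, \<tau>) \<in> section_eq U (along X A D)"
  shows "push_sets X U D \<sigma> = push_sets X U D \<tau>"
proof -
  have *: "{t. \<exists>y. \<tau> t = Some y \<and> (fst t, y) \<in> S} \<in> U"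
    if e: "(\<sigma>, \<tau>) \<in> section_eq U (along X A D)" and S: "{t. \<exists>y. \<sigma> t = Some y \<and> (fst t, y) \<in> S} \<in> U" for \<sigma> \<tau> S
  proof -
    obtain W where W: "W \<in> U" "\<And>s. s \<in> W \<Longrightarrow> \<exists>y. \<sigma> s = Some y \<and> \<tau> s = Some y"
      and \<tau>: "\<tau> \<in> partial_sections U (along X A D)"
      using e by (elim section_eqE) blast
    have "dom \<tau> \<in> U"
      using \<tau> by (simp add: partial_sections_iff)
    then have "dom \<tau> \<subseteq> Sigma X A"
      by (rule ultrafilter_subset[OF U])
    then show ?thesis
      by (intro ultrafilter_mono[OF U ultrafilter_Int[OF U W(1) S]]) (use W(2) in fastforce)+
  qed
  have "(\<tau>, \<sigma>) \<in> section_eq U (along X A D)"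
    using assms equiv_section_eq[OF U] by (auto simp: equiv_def dest: symD)
  then show ?thesis
    using *[OF assms] * by (auto simp: push_sets_def)
qed

lemma partial_maps_iff:
  "(u, f) \<in> partial_maps (Fam X) (ultra_object X A U) D \<longleftrightarrow>
    u \<in> coprojections (Fam X) A \<and> total_image X u \<in> U \<and> f \<in> Arr (Fam X) \<and> src f = src u \<and> tgt f = D"
proof (cases "u \<in> coprojections (Fam X) A")
  case True
  have "total_image X u \<subseteq> Sigma X A"
    using total_image_subset[OF coprojection_arr[OF True]] coprojection_tgt[OF True] by simp
  then show ?thesis
    using True summand_class_eq[OF True] sub_class_in_object_ultrafilter[OF A]
    by (simp add: partial_maps_def)
qed (simp add: partial_maps_def)

lemma section_of_in:
  assumes "m \<in> partial_maps (Fam X) (ultra_object X A U) D"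
  shows "section_of m \<in> partial_sections U (along X A D)"
proof -
  obtain u f where m: "m = (u, f)" by (cases m)
  have u: "u \<in> coprojections (Fam X) A" "total_image X u \<in> U" and f: "f \<in> Arr (Fam X)" "src f = src u" "tgt f = D"
    using assms unfolding m partial_maps_iff by auto
  have "y \<in> D (fst t)" if "section_of (u, f) t = Some y" for t y
    using that section_of_iff[OF u(1), of f "fst t" "snd t" y] act_in[OF f(1), of _ "fst t"] f by auto
  then show ?thesis
    using u dom_section_of[OF coprojection_arr[OF u(1)]] by (auto simp: m pulled_sections_iff[OF U])
qed

text \<open>The partial map consists of the inclusion of \<open>dom \<sigma>\<close> and of
  \<open>\<sigma>\<close> itself, read as a total map on that subfamily.\<close>

lemma section_of_surj:
  assumes D: "D \<in> families X" and \<sigma>: "\<sigma> \<in> partial_sections U (along X A D)"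
  obtains m where "m \<in> partial_maps (Fam X) (ultra_object X A U) D" "section_of m = \<sigma>"
proof -
  have d: "dom \<sigma> \<in> U" and val: "\<And>t y. \<sigma> t = Some y \<Longrightarrow> y \<in> D (fst t)"
    using \<sigma> by (auto simp: pulled_sections_iff[OF U])
  have ds: "dom \<sigma> \<subseteq> Sigma X A"
    by (rule ultrafilter_subset[OF U d])
  let ?u = "inclusion A (dom \<sigma>)"
  define f where "f = mk_arr (src ?u) D (\<lambda>x a. the (\<sigma> (x, a)))"
  have u: "?u \<in> coprojections (Fam X) A"
    by (rule inclusion_coprojection[OF A ds])
  have f: "f \<in> Arr (Fam X)"
    unfolding f_def using val
    by (intro mk_arr_in src_families[OF coprojection_arr[OF u]] D) fastforce
  have "(?u, f) \<in> partial_maps (Fam X) (ultra_object X A U) D"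
    unfolding partial_maps_iff using u f total_image_inclusion[OF A ds] d by (simp add: f_def)
  moreover have "section_of (?u, f) t = \<sigma> t" for t
  proof -
    obtain x y where t: "t = (x, y)" by (cases t)
    have "section_of (?u, f) t = Some z \<longleftrightarrow> \<sigma> t = Some z" for z
      unfolding t section_of_iff[OF u] by (auto simp: f_def domI)
    then show ?thesis
      by (cases "\<sigma> t") (metis option.exhaust)+
  qed
  ultimately show thesis
    using that by blast
qed

text \<open>The image of the coprojection \<open>w\<close> on which two partial maps coincide is a
  set on which their sections agree. Conversely, the inclusion of a set of agreement factors through
  both domains, because both sections are defined on it.\<close>

lemma coincide_iff:
  assumes "m \<in> partial_maps (Fam X) (ultra_object X A U) D" "m' \<in> partial_maps (Fam X) (ultra_object X A U) D"
  shows "coincide (Fam X) (ultra_object X A U) m m' \<longleftrightarrow> (section_of m, section_of m') \<in> section_eq U (along X A D)"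
proof -
  obtain u f v g where m: "m = (u, f)" "m' = (v, g)" by (cases m; cases m')
  have u: "u \<in> coprojections (Fam X) A" and f: "f \<in> Arr (Fam X)" "src f = src u" "tgt f = D"
    and v: "v \<in> coprojections (Fam X) A" and g: "g \<in> Arr (Fam X)" "src g = src v" "tgt g = D"
    using assms unfolding m partial_maps_iff by auto
  have summand: "summand_class (Fam X) w \<in> object_ultrafilter X A U \<longleftrightarrow> total_image X w \<in> U"
    if "w \<in> coprojections (Fam X) A" for w
    using sub_class_in_object_ultrafilter[OF A] summand_class_eq[OF that]
      total_image_subset[OF coprojection_arr[OF that]] coprojection_tgt[OF that] by simp
  show ?thesis
  proof
    assume "coincide (Fam X) (ultra_object X A U) m m'"
    then obtain w h k where w: "w \<in> coprojections (Fam X) A" "summand_class (Fam X) w \<in> object_ultrafilter X A U"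
      and h: "h \<in> Arr (Fam X)" "src h = src w" "tgt h = src u" "Comp (Fam X) u h = w"
      and k: "k \<in> Arr (Fam X)" "src k = src w" "tgt k = src v" "Comp (Fam X) v k = w"
      and eq: "Comp (Fam X) f h = Comp (Fam X) g k"
      unfolding coincide_def m split_conv Fam_Dom Fam_Cod by blast
    show "(section_of m, section_of m') \<in> section_eq U (along X A D)"
    proof (rule section_eqI[OF section_of_in[OF assms(1)] section_of_in[OF assms(2)]])
      show "total_image X w \<in> U"
        using summand[OF w(1)] w(2) by simp
      fix t assume "t \<in> total_image X w"
      then obtain x c where c: "c \<in> src w x" "t = (x, act w x c)"
        using in_total_image[OF coprojection_arr[OF w(1)], of "fst t" "snd t"] by (cases t) auto
      have e: "act u x (act h x c) = act w x c" "act v x (act k x c) = act w x c"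
        "act f x (act h x c) = act g x (act k x c)"
        using act_Comp_eq[OF h(4)] act_Comp_eq[OF k(4)] act_Comp_eqD[OF eq] c(1) h(2) k(2) by auto
      have "act h x c \<in> src u x" "act k x c \<in> src v x"
        using act_in[OF h(1), of c x] act_in[OF k(1), of c x] c(1) h(2,3) k(2,3) by auto
      then have "section_of m t = Some (act f x (act h x c))" "section_of m' t = Some (act f x (act h x c))"
        unfolding m c(2) section_of_iff[OF u] section_of_iff[OF v] using e by auto
      then show "\<exists>y. section_of m t = Some y \<and> section_of m' t = Some y"
        by blast
    qed
  next
    assume "(section_of m, section_of m') \<in> section_eq U (along X A D)"
    then obtain W where W: "W \<in> U" "\<And>t. t \<in> W \<Longrightarrow> \<exists>y. section_of m t = Some y \<and> section_of m' t = Some y"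
      by (elim section_eqE) blast
    have WA: "W \<subseteq> Sigma X A"
      by (rule ultrafilter_subset[OF U W(1)])
    let ?w = "inclusion A W"
    have w: "?w \<in> coprojections (Fam X) A"
      by (rule inclusion_coprojection[OF A WA])
    note wa = coprojection_arr[OF w] and wt = coprojection_tgt[OF w]
    have Wu: "W \<subseteq> total_image X u" and Wv: "W \<subseteq> total_image X v"
      using W(2) dom_section_of[OF coprojection_arr[OF u], of f] dom_section_of[OF coprojection_arr[OF v], of g]
      by (auto simp: m dom_def set_eq_iff) blast+
    obtain h where h: "h \<in> Arr (Fam X)" "src h = src ?w" "tgt h = src u" "Comp (Fam X) u h = ?w"
      by (rule factor_through[OF u wa wt]) (use Wu total_image_inclusion[OF A WA] in auto)
    obtain k where k: "k \<in> Arr (Fam X)" "src k = src ?w" "tgt k = src v" "Comp (Fam X) v k = ?w"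
      by (rule factor_through[OF v wa wt]) (use Wv total_image_inclusion[OF A WA] in auto)
    have "Comp (Fam X) f h = Comp (Fam X) g k"
    proof (rule arr_eqI)
      show "Comp (Fam X) f h \<in> Arr (Fam X)" "Comp (Fam X) g k \<in> Arr (Fam X)"
        using h(1,3) k(1,3) f g by (auto intro!: Fam_Comp_in)
      show "src (Comp (Fam X) f h) = src (Comp (Fam X) g k)" "tgt (Comp (Fam X) f h) = tgt (Comp (Fam X) g k)"
        using h(2) k(2) f g by auto
      fix x a assume "a \<in> src (Comp (Fam X) f h) x"
      then have ah: "a \<in> src h x" and ak: "a \<in> src k x" and aW: "(x, a) \<in> W"
        using h(2) k(2) by auto
      obtain y where y: "section_of m (x, a) = Some y" "section_of m' (x, a) = Some y"
        using W(2)[OF aW] by blast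
      have "act u x (act h x a) = a" "act v x (act k x a) = a"
        using act_Comp_eq[OF h(4) ah] act_Comp_eq[OF k(4) ak] aW by auto
      moreover have "act h x a \<in> src u x" "act k x a \<in> src v x"
        using act_in[OF h(1) ah] act_in[OF k(1) ak] h(3) k(3) by auto
      ultimately have "section_of m (x, a) = Some (act f x (act h x a))"
        "section_of m' (x, a) = Some (act g x (act k x a))"
        unfolding m section_of_iff[OF u] section_of_iff[OF v] by auto
      then show "act (Comp (Fam X) f h) x a = act (Comp (Fam X) g k) x a"
        using y ah ak by simp
    qed
    moreover have "summand_class (Fam X) ?w \<in> object_ultrafilter X A U"
      using summand[OF w] total_image_inclusion[OF A WA] W(1) by simp
    ultimately show "coincide (Fam X) (ultra_object X A U) m m'"
      unfolding coincide_def m split_conv Fam_Dom Fam_Cod using w h k by blast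
  qed
qed

lemma germ_eq:
  assumes m: "m \<in> partial_maps (Fam X) (ultra_object X A U) D"
  shows "germ (Fam X) (ultra_object X A U) m = germ_of_class X A U D (section_eq U (along X A D) `` {section_of m})"
proof -
  obtain u f where uf: "m = (u, f)" by (cases m)
  have t: "tgt f = D"
    using m unfolding uf partial_maps_iff by simp
  have "germ (Fam X) (ultra_object X A U) m = {m' \<in> partial_maps (Fam X) (ultra_object X A U) D. coincide (Fam X) (ultra_object X A U) m m'}"
    by (auto simp: germ_def uf t)
  also have "\<dots> = germ_of_class X A U D (section_eq U (along X A D) `` {section_of m})"
    using coincide_iff[OF m] by (auto simp: germ_of_class_def)
  finally show ?thesis .
qed

text \<open>Pulling \<open>W\<close> back along \<open>f\<close> and composing with \<open>u\<close>
  produces the preimage of \<open>W\<close> under the section. Continuity therefore says that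
  \<open>V\<close> and the image ultrafilter contain the same summands, which is equality as both
  consist of summands only.\<close>

lemma continuous_map_iff:
  assumes m: "m \<in> partial_maps (Fam X) (ultra_object X A U) D" and D: "D \<in> families X" and V: "V \<subseteq> Summands (Fam X) D"
  shows "continuous_map (Fam X) (ultra_object X A U) (D, V) m \<longleftrightarrow> V = object_ultrafilter X D (push_sets X U D (section_of m))"
proof -
  obtain u f where uf: "m = (u, f)" by (cases m)
  have u: "u \<in> coprojections (Fam X) A" and f: "f \<in> Arr (Fam X)" "src f = src u" "tgt f = D"
    using m unfolding uf partial_maps_iff by auto
  have pre: "Comp (Fam X) u ` inverse_image (Fam X) f (sub_class X D W) \<in> object_ultrafilter X A U \<longleftrightarrow>
      sub_class X D W \<in> object_ultrafilter X D (push_sets X U D (section_of m))"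
    if W: "W \<subseteq> Sigma X D" for W
  proof -
    let ?I = "{(x, a). a \<in> src f x \<and> (x, act f x a) \<in> W}"
    have I: "?I \<subseteq> Sigma X (src u)"
      using f(2) index_in[OF src_families[OF f(1)]] by auto
    have "inverse_image (Fam X) f (sub_class X D W) = sub_class X (src u) ?I"
      using inverse_image_sub_class[OF f(1), of W] W f(2,3) by simp
    then have "Comp (Fam X) u ` inverse_image (Fam X) f (sub_class X D W) =
        sub_class X A {(x, y). \<exists>a. (x, a) \<in> ?I \<and> act u x a = y}"
      using Comp_image_sub_class[OF u I] by simp
    also have "{(x, y). \<exists>a. (x, a) \<in> ?I \<and> act u x a = y} =
        {t. \<exists>y. section_of m t = Some y \<and> (fst t, y) \<in> W}"
      using f(2) by (fastforce simp: uf section_of_iff[OF u])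
    finally have e: "Comp (Fam X) u ` inverse_image (Fam X) f (sub_class X D W) =
        sub_class X A {t. \<exists>y. section_of m t = Some y \<and> (fst t, y) \<in> W}" .
    have "dom (section_of m) \<subseteq> Sigma X A"
      using ultrafilter_subset[OF U] section_of_in[OF m] by (auto simp: partial_sections_iff)
    then have sub: "{t. \<exists>y. section_of m t = Some y \<and> (fst t, y) \<in> W} \<subseteq> Sigma X A"
      by blast
    then show ?thesis
      unfolding e sub_class_in_object_ultrafilter[OF A sub]
        sub_class_in_object_ultrafilter[OF D W] using W by (simp add: push_sets_def)
  qed
  have "continuous_map (Fam X) (ultra_object X A U) (D, V) m \<longleftrightarrow>
      (\<forall>W. W \<subseteq> Sigma X D \<longrightarrow> (sub_class X D W \<in> V \<longleftrightarrow>
        Comp (Fam X) u ` inverse_image (Fam X) f (sub_class X D W) \<in> object_ultrafilter X A U))"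
    unfolding uf continuous_map_def split_conv Summands_eq[OF D] by blast
  also have "\<dots> \<longleftrightarrow> (\<forall>W. W \<subseteq> Sigma X D \<longrightarrow> (sub_class X D W \<in> V \<longleftrightarrow>
        sub_class X D W \<in> object_ultrafilter X D (push_sets X U D (section_of m))))"
    using pre by simp
  also have "\<dots> \<longleftrightarrow> V = object_ultrafilter X D (push_sets X U D (section_of m))"
    using subset_Summands_eqI[OF D V Summands_object_ultrafilter] by blast
  finally show ?thesis .
qed

end

section \<open>The isomorphism\<close>

text \<open>All the sets \<open>push_sets X U D \<sigma>\<close> with \<open>\<sigma> \<in> c\<close> are equal; the union only avoids choosing
  a representative of the class \<open>c\<close>.\<close>

definition ultrapoint where
  "ultrapoint X A U D c =
    (let V = object_ultrafilter X D (\<Union>\<sigma>\<in>c. push_sets X U D \<sigma>)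
     in (V, (ultra_object X A U, (D, V), germ_of_class X A U D c)))"

context
  fixes X :: "'x set" and A :: "('x, 'u::infinite) family" and U :: "('x \<times> 'u) set set"
  assumes A: "A \<in> families X" and U: "ultrafilter_on (Sigma X A) U"
begin

abbreviation (input) ultra where "ultra \<equiv> functor_comp (ultraproduct U) (reindex (Sigma X A) fst)"
abbreviation (input) points where "points \<equiv> integral (Fam X) (representable (UF (Fam X)) (ultra_object X A U))"

lemma Union_push_sets:
  assumes "\<sigma> \<in> partial_sections U (along X A D)"
  shows "(\<Union>\<tau>\<in>section_eq U (along X A D) `` {\<sigma>}. push_sets X U D \<tau>) = push_sets X U D \<sigma>"
proof -
  have "push_sets X U D \<tau> = push_sets X U D \<sigma>" if "\<tau> \<in> section_eq U (along X A D) `` {\<sigma>}" for \<tau>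
    using push_sets_cong[OF A U, of \<sigma> \<tau> D] that by simp
  moreover have "\<sigma> \<in> section_eq U (along X A D) `` {\<sigma>}"
    by (rule equiv_class_self[OF equiv_section_eq[OF U] assms])
  ultimately show ?thesis
    by blast
qed

lemma ultrapoint_eq:
  assumes "\<sigma> \<in> partial_sections U (along X A D)"
  shows "ultrapoint X A U D (section_eq U (along X A D) `` {\<sigma>}) =
    (object_ultrafilter X D (push_sets X U D \<sigma>),
      (ultra_object X A U, (D, object_ultrafilter X D (push_sets X U D \<sigma>)),
        germ_of_class X A U D (section_eq U (along X A D) `` {\<sigma>})))"
  by (simp add: ultrapoint_def Let_def Union_push_sets[OF assms])

lemma in_points_iff:
  assumes D: "D \<in> families X"
  shows "w \<in> On_obj points D \<longleftrightarrow>
    (\<exists>V m. V \<in> beta (Fam X) D \<and> m \<in> partial_maps (Fam X) (ultra_object X A U) D \<and>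
       continuous_map (Fam X) (ultra_object X A U) (D, V) m \<and> w = (V, (ultra_object X A U, (D, V), germ (Fam X) (ultra_object X A U) m)))"
  using A D object_ultrafilter_beta[OF A U]
  by (auto simp: integral_def representable_def UF_def) blast

text \<open>A class can be recovered from its germ, since each of its sections comes from a partial
  map. For surjectivity, continuity forces the ultrafilter component to be the image of
  \<open>U\<close> under the section.\<close>

lemma ultrapoint_bij:
  assumes D: "D \<in> families X"
  shows "bij_betw (ultrapoint X A U D) (On_obj ultra D) (On_obj points D)"
  unfolding bij_betw_def
proof
  show "inj_on (ultrapoint X A U D) (On_obj ultra D)"
  proof (rule inj_onI)
    fix c d assume c: "c \<in> On_obj ultra D" and d: "d \<in> On_obj ultra D"
      and eq: "ultrapoint X A U D c = ultrapoint X A U D d"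
    obtain \<sigma> where \<sigma>: "\<sigma> \<in> partial_sections U (along X A D)" "c = section_eq U (along X A D) `` {\<sigma>}"
      using c by (rule pulled_classE[OF U])
    obtain \<tau> where \<tau>: "\<tau> \<in> partial_sections U (along X A D)" "d = section_eq U (along X A D) `` {\<tau>}"
      using d by (rule pulled_classE[OF U])
    obtain m where m: "m \<in> partial_maps (Fam X) (ultra_object X A U) D" "section_of m = \<sigma>"
      by (rule section_of_surj[OF A U D \<sigma>(1)])
    have "\<sigma> \<in> c"
      unfolding \<sigma>(2) by (rule equiv_class_self[OF equiv_section_eq[OF U] \<sigma>(1)])
    then have "m \<in> germ_of_class X A U D c"
      using m by (simp add: germ_of_class_def)
    moreover have "germ_of_class X A U D c = germ_of_class X A U D d"
      using eq by (simp add: ultrapoint_def Let_def)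
    ultimately have "m \<in> germ_of_class X A U D d"
      by (simp only:)
    then have "\<sigma> \<in> d"
      using m by (simp add: germ_of_class_def)
    then have "(\<tau>, \<sigma>) \<in> section_eq U (along X A D)"
      by (simp add: \<tau>(2))
    from equiv_class_eq[OF equiv_section_eq[OF U] this] show "c = d"
      using \<sigma> \<tau> by simp
  qed
  show "ultrapoint X A U D ` On_obj ultra D = On_obj points D"
  proof (intro equalityI image_subsetI subsetI)
    fix c assume "c \<in> On_obj ultra D"
    then obtain \<sigma> where \<sigma>: "\<sigma> \<in> partial_sections U (along X A D)" "c = section_eq U (along X A D) `` {\<sigma>}"
      by (rule pulled_classE[OF U])
    obtain m where m: "m \<in> partial_maps (Fam X) (ultra_object X A U) D" "section_of m = \<sigma>"
      by (rule section_of_surj[OF A U D \<sigma>(1)])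
    let ?V = "object_ultrafilter X D (push_sets X U D \<sigma>)"
    have "?V \<in> beta (Fam X) D"
      by (rule object_ultrafilter_beta[OF D push_sets_ultrafilter[OF A U D \<sigma>(1)]])
    moreover have "continuous_map (Fam X) (ultra_object X A U) (D, ?V) m"
      using continuous_map_iff[OF A U m(1) D Summands_object_ultrafilter] m(2) by simp
    moreover have "ultrapoint X A U D c = (?V, (ultra_object X A U, (D, ?V), germ (Fam X) (ultra_object X A U) m))"
      unfolding \<sigma>(2) ultrapoint_eq[OF \<sigma>(1)] germ_eq[OF A U m(1)] m(2) ..
    ultimately show "ultrapoint X A U D c \<in> On_obj points D"
      unfolding in_points_iff[OF D] using m(1) by blast
  next
    fix w assume "w \<in> On_obj points D"
    then obtain V m where V: "V \<in> beta (Fam X) D" and m: "m \<in> partial_maps (Fam X) (ultra_object X A U) D"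
      and cont: "continuous_map (Fam X) (ultra_object X A U) (D, V) m" and w: "w = (V, (ultra_object X A U, (D, V), germ (Fam X) (ultra_object X A U) m))"
      unfolding in_points_iff[OF D] by blast
    have VS: "V \<subseteq> Summands (Fam X) D"
      using V by (simp add: beta_def)
    have V': "V = object_ultrafilter X D (push_sets X U D (section_of m))"
      using continuous_map_iff[OF A U m D VS] cont by simp
    note \<sigma> = section_of_in[OF A U m]
    have "w = ultrapoint X A U D (section_eq U (along X A D) `` {section_of m})"
      unfolding w ultrapoint_eq[OF \<sigma>] germ_eq[OF A U m] V'[symmetric] ..
    then show "w \<in> ultrapoint X A U D ` On_obj ultra D"
      using pulled_classI[OF U \<sigma>] by blast
  qed
qed

text \<open>Taking the preimage of \<open>W\<close> first along \<open>f\<close> and then along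
  \<open>\<sigma>\<close> is taking it along the section composed with \<open>f\<close>, so the
  ultrafilter components match in the naturality square.\<close>

lemma push_object_ultrafilter:
  assumes f: "f \<in> Arr (Fam X)" and \<sigma>: "\<sigma> \<in> partial_sections U (along X A (src f))"
  shows "push (Fam X) f (object_ultrafilter X (src f) (push_sets X U (src f) \<sigma>)) =
    object_ultrafilter X (tgt f) (push_sets X U (tgt f) (\<lambda>t. map_option (act f (fst t)) (\<sigma> t)))"
proof (rule subset_Summands_eqI[OF tgt_families[OF f] _ Summands_object_ultrafilter])
  show "push (Fam X) f (object_ultrafilter X (src f) (push_sets X U (src f) \<sigma>)) \<subseteq> Summands (Fam X) (tgt f)"
    by (auto simp: push_def)
  fix W assume W: "W \<subseteq> Sigma X (tgt f)"
  let ?I = "{(x, a). a \<in> src f x \<and> (x, act f x a) \<in> W}"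
  have I: "?I \<subseteq> Sigma X (src f)"
    using index_in[OF src_families[OF f]] by auto
  have val: "y \<in> src f (fst t)" if "\<sigma> t = Some y" for t y
    using \<sigma> that by (auto simp: pulled_sections_iff[OF U])
  have "{t. \<exists>y. \<sigma> t = Some y \<and> (fst t, y) \<in> ?I} =
      {t. \<exists>y. map_option (act f (fst t)) (\<sigma> t) = Some y \<and> (fst t, y) \<in> W}"
    using val by fastforce
  then have "?I \<in> push_sets X U (src f) \<sigma> \<longleftrightarrow>
      W \<in> push_sets X U (tgt f) (\<lambda>t. map_option (act f (fst t)) (\<sigma> t))"
    using W I by (simp add: push_sets_def)
  then show "sub_class X (tgt f) W \<in> push (Fam X) f (object_ultrafilter X (src f) (push_sets X U (src f) \<sigma>)) \<longleftrightarrow>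
      sub_class X (tgt f) W \<in> object_ultrafilter X (tgt f)
        (push_sets X U (tgt f) (\<lambda>t. map_option (act f (fst t)) (\<sigma> t)))"
    using sub_class_in_Summands[OF tgt_families[OF f] W] inverse_image_sub_class[OF f W]
      sub_class_in_object_ultrafilter[OF src_families[OF f] I]
      sub_class_in_object_ultrafilter[OF tgt_families[OF f] W]
    by (simp add: push_def)
qed

text \<open>The result mentions neither the representatives \<open>(u, f')\<close> and
  \<open>(v, g)\<close> nor the pullback, so every member of the union that defines composition in
  \<open>UF\<close> is this one germ.\<close>

lemma compose_germ:
  assumes f: "f \<in> Arr (Fam X)" and \<sigma>: "\<sigma> \<in> partial_sections U (along X A (src f))"
    and uf': "(u, f') \<in> germ_of_class X A U (src f) (section_eq U (along X A (src f)) `` {\<sigma>})"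
    and vg: "(v, g) \<in> germ (Fam X) (src f, object_ultrafilter X (src f) (push_sets X U (src f) \<sigma>))
      (Ident (Fam X) (src f), f)"
    and pb: "is_pullback (Fam X) f' v p q"
  shows "germ (Fam X) (ultra_object X A U) (Comp (Fam X) u p, Comp (Fam X) g q) =
    germ_of_class X A U (tgt f) (section_eq U (along X A (tgt f)) `` {\<lambda>t. map_option (act f (fst t)) (\<sigma> t)})"
proof -
  let ?V = "push_sets X U (src f) \<sigma>" and ?\<sigma>' = "\<lambda>t. map_option (act f (fst t)) (\<sigma> t)"
  note D = src_families[OF f]
  have V: "ultrafilter_on (Sigma X (src f)) ?V"
    by (rule push_sets_ultrafilter[OF A U D \<sigma>])
  note idc = Ident_coprojection[OF D]
  have idf: "(Ident (Fam X) (src f), f) \<in> partial_maps (Fam X) (src f, object_ultrafilter X (src f) ?V) (tgt f)"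
    unfolding partial_maps_iff[OF D V] using idc total_image_Ident[OF D] f ultrafilter_top[OF V] by simp
  have vg': "(v, g) \<in> partial_maps (Fam X) (src f, object_ultrafilter X (src f) ?V) (tgt f)"
    and vgs: "(section_of (Ident (Fam X) (src f), f), section_of (v, g)) \<in>
      section_eq ?V (On_obj (reindex (Sigma X (src f)) fst) (tgt f))"
    using vg unfolding germ_eq[OF D V idf] germ_of_class_def by auto
  have uf: "(u, f') \<in> partial_maps (Fam X) (ultra_object X A U) (src f)"
    and ufs: "(\<sigma>, section_of (u, f')) \<in> section_eq U (along X A (src f))"
    using uf' unfolding germ_of_class_def by auto
  have u: "u \<in> coprojections (Fam X) A" and f': "f' \<in> Arr (Fam X)" "src f' = src u" "tgt f' = src f"
    using uf unfolding partial_maps_iff[OF A U] by auto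
  have v: "v \<in> coprojections (Fam X) (src f)" and g: "g \<in> Arr (Fam X)" "src g = src v" "tgt g = tgt f"
    using vg' unfolding partial_maps_iff[OF D V] by auto
  have v': "v \<in> coprojections (Fam X) (tgt f')"
    using v f'(3) by simp
  have p: "p \<in> coprojections (Fam X) (src u)" and q: "q \<in> Arr (Fam X)" "src q = src p" "tgt q = src v"
    using pb f'(2) unfolding Fam_pullback_iff[OF f'(1) v'] by auto
  let ?m = "(Comp (Fam X) u p, Comp (Fam X) g q)"
  have up: "Comp (Fam X) u p \<in> coprojections (Fam X) A"
    by (rule Comp_coprojection[OF u p])
  obtain W1 where W1: "W1 \<in> U" "\<And>t. t \<in> W1 \<Longrightarrow> \<exists>y. \<sigma> t = Some y \<and> section_of (u, f') t = Some y"
    using ufs by (elim section_eqE) blast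
  obtain W2 where W2: "W2 \<in> ?V"
    "\<And>s. s \<in> W2 \<Longrightarrow> \<exists>z. section_of (Ident (Fam X) (src f), f) s = Some z \<and> section_of (v, g) s = Some z"
    using vgs by (elim section_eqE) blast
  \<comment> \<open>\<open>(u, f')\<close> agrees with \<open>\<sigma>\<close> on \<open>W1\<close>,
    and \<open>(v, g)\<close> agrees with \<open>f\<close> on \<open>W2\<close>. The latter set is
    large only for the image ultrafilter, but by the definition of \<open>push_sets\<close> this
    means that its preimage under \<open>\<sigma>\<close> is in \<open>U\<close>.\<close>
  define W where "W = W1 \<inter> {t. \<exists>y. \<sigma> t = Some y \<and> (fst t, y) \<in> W2}"
  have W: "W \<in> U"
    unfolding W_def using W2(1) by (intro ultrafilter_Int[OF U W1(1)]) (simp add: push_sets_def)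
  have agree: "\<exists>z. ?\<sigma>' t = Some z \<and> section_of ?m t = Some z" if tW: "t \<in> W" for t
  proof -
    obtain x y where t: "t = (x, y)" by (cases t)
    obtain w where w: "\<sigma> t = Some w" "(x, w) \<in> W2"
      using tW t by (auto simp: W_def)
    have "section_of (u, f') (x, y) = Some w"
      using W1(2)[of t] tW w t by (auto simp: W_def)
    moreover have "section_of (v, g) (x, w) = Some (act f x w)"
      using W2(2)[OF w(2)] section_of_identity[OF D, of f x w] by auto
    ultimately have "section_of ?m (x, y) = Some (act f x w)"
      using section_of_comp[OF u f'(1,2) v' g(2) pb] by blast
    then show ?thesis
      using w t by simp
  qed
  \<comment> \<open>The composite is defined on a set containing \<open>W\<close>, so its domain
    lies in the ultrafilter and it is a partial map in the required sense.\<close>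
  have "total_image X (Comp (Fam X) u p) \<in> U"
  proof (rule ultrafilter_mono[OF U W])
    show "W \<subseteq> total_image X (Comp (Fam X) u p)"
      unfolding dom_section_of[OF coprojection_arr[OF up], of "Comp (Fam X) g q", symmetric]
      using agree by blast
    show "total_image X (Comp (Fam X) u p) \<subseteq> Sigma X A"
      using total_image_subset[OF coprojection_arr[OF up]] coprojection_tgt[OF up] by simp
  qed
  then have m: "?m \<in> partial_maps (Fam X) (ultra_object X A U) (tgt f)"
    unfolding partial_maps_iff[OF A U] using up q g by (auto intro: Fam_Comp_in)
  have \<sigma>': "?\<sigma>' \<in> partial_sections U (along X A (tgt f))"
    using pulled_post[OF U f \<sigma>] .
  have "(?\<sigma>', section_of ?m) \<in> section_eq U (along X A (tgt f))"
    by (rule section_eqI[OF \<sigma>' section_of_in[OF A U m] W agree])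
  from equiv_class_eq[OF equiv_section_eq[OF U] this] show ?thesis
    unfolding germ_eq[OF A U m] by simp
qed

text \<open>By \<open>compose_germ\<close> the union defining the composite ranges over a single
  germ at most; it equals that germ once one composable pair of representatives with a pullback has
  been exhibited.\<close>

lemma points_arr:
  assumes f: "f \<in> Arr (Fam X)" and \<sigma>: "\<sigma> \<in> partial_sections U (along X A (src f))"
  shows "On_arr points f (ultrapoint X A U (src f) (section_eq U (along X A (src f)) `` {\<sigma>})) =
    ultrapoint X A U (tgt f) (section_eq U (along X A (tgt f)) `` {\<lambda>t. map_option (act f (fst t)) (\<sigma> t)})"
proof -
  let ?V = "push_sets X U (src f) \<sigma>" and ?\<sigma>' = "\<lambda>t. map_option (act f (fst t)) (\<sigma> t)"
  let ?O = "object_ultrafilter X (src f) ?V"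
  let ?F = "germ_of_class X A U (src f) (section_eq U (along X A (src f)) `` {\<sigma>})"
  let ?G = "germ (Fam X) (src f, ?O) (Ident (Fam X) (src f), f)"
  let ?H = "germ_of_class X A U (tgt f) (section_eq U (along X A (tgt f)) `` {?\<sigma>'})"
  note D = src_families[OF f]
  have V: "ultrafilter_on (Sigma X (src f)) ?V"
    by (rule push_sets_ultrafilter[OF A U D \<sigma>])
  have \<sigma>': "?\<sigma>' \<in> partial_sections U (along X A (tgt f))"
    using pulled_post[OF U f \<sigma>] .
  note idc = Ident_coprojection[OF D]
  have idf: "(Ident (Fam X) (src f), f) \<in> partial_maps (Fam X) (src f, ?O) (tgt f)"
    unfolding partial_maps_iff[OF D V] using idc total_image_Ident[OF D] f ultrafilter_top[OF V] by simp
  have G: "(Ident (Fam X) (src f), f) \<in> ?G"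
    unfolding germ_eq[OF D V idf] germ_of_class_def
    using idf equiv_class_self[OF equiv_section_eq[OF V] section_of_in[OF D V idf]] by simp
  obtain m where m: "m \<in> partial_maps (Fam X) (ultra_object X A U) (src f)" "section_of m = \<sigma>"
    by (rule section_of_surj[OF A U D \<sigma>])
  obtain u f' where uf: "m = (u, f')" by (cases m)
  have F: "(u, f') \<in> ?F"
    unfolding germ_of_class_def
    using m equiv_class_self[OF equiv_section_eq[OF U] \<sigma>] by (simp add: uf)
  have f': "f' \<in> Arr (Fam X)" "src f' = src u" "tgt f' = src f"
    using m(1) unfolding uf partial_maps_iff[OF A U] by auto
  note idc' = Ident_coprojection[OF src_families[OF f'(1)]]
  have idc'': "Ident (Fam X) (src f) \<in> coprojections (Fam X) (tgt f')"
    using idc f'(3) by simp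
  have "Comp (Fam X) f' (Ident (Fam X) (src f')) = Comp (Fam X) (Ident (Fam X) (src f)) f'"
  proof (rule arr_eqI)
    show "Comp (Fam X) f' (Ident (Fam X) (src f')) \<in> Arr (Fam X)"
      "Comp (Fam X) (Ident (Fam X) (src f)) f' \<in> Arr (Fam X)"
      using f' src_families[OF f'(1)] D by (auto intro!: Fam_Comp_in Fam_Ident_in)
  qed (use f' act_in[OF f'(1)] in auto)
  moreover have "(x, a) \<in> total_image X (Ident (Fam X) (src f'))" if "a \<in> src f' x" for x a
    using that in_total_image[OF coprojection_arr[OF idc']] by simp
  \<comment> \<open>The pullback of an identity along \<open>f'\<close> shows that the collection of
    composites is inhabited; an empty one would have the empty union.\<close>
  ultimately have pb: "is_pullback (Fam X) f' (Ident (Fam X) (src f)) (Ident (Fam X) (src f')) f'"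
    unfolding Fam_pullback_iff[OF f'(1) idc''] using idc' f' by simp
  let ?\<G> = "{germ (Fam X) (ultra_object X A U) (Comp (Fam X) u p, Comp (Fam X) g q) | u f v g p q.
      (u, f) \<in> ?F \<and> (v, g) \<in> ?G \<and> is_pullback (Fam X) f v p q}"
  have "?\<G> \<subseteq> {?H}"
    using compose_germ[OF f \<sigma>] by blast
  moreover have "?\<G> \<noteq> {}"
    using F G pb by blast
  ultimately have "?\<G> = {?H}"
    by blast
  then have "\<Union>?\<G> = ?H"
    by simp
  then show ?thesis
    unfolding ultrapoint_eq[OF \<sigma>] ultrapoint_eq[OF \<sigma>'] push_object_ultrafilter[OF f \<sigma>, symmetric]
    by (simp add: integral_def representable_def UF_def)
qed

lemma ultrapoint_natural_iso:
  "natural_iso (Fam X) ultra points (ultrapoint X A U)"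
  unfolding natural_iso_def Fam_Obj Fam_Dom Fam_Cod
proof (intro conjI ballI ultrapoint_bij)
  fix f :: "('x, 'u) family_map" and c
  assume f: "f \<in> Arr (Fam X)" and c: "c \<in> On_obj ultra (src f)"
  obtain \<sigma> where \<sigma>: "\<sigma> \<in> partial_sections U (along X A (src f))" "c = section_eq U (along X A (src f)) `` {\<sigma>}"
    using c by (rule pulled_classE[OF U])
  show "ultrapoint X A U (tgt f) (On_arr ultra f c) = On_arr points f (ultrapoint X A U (src f) c)"
    unfolding \<sigma>(2) pulled_arr[OF U f \<sigma>(1)] points_arr[OF f \<sigma>(1)] ..
qed

lemma representable_isomorphic_ultraproduct: "FC_isomorphic (Fam X) points ultra"
  by (rule FC_isomorphic_sym[OF pulled_FC_object[OF U] ultrapoint_natural_iso])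

end

section \<open>The terminal family\<close>

lemma terminal_singleton:
  fixes T :: "('x, 'u::infinite) family"
  assumes T: "is_terminal (Fam X) T" and x: "x \<in> X"
  shows "\<exists>e. T x = {e}"
proof -
  have Tf: "T \<in> families X"
    using T by (simp add: is_terminal_def)
  \<comment> \<open>Maps out of a family with one element over each index of \<open>X\<close> are
    global sections of \<open>T\<close>, whatever that element is. Existence of such a map makes
    each fibre of \<open>T\<close> inhabited.\<close>
  define r :: 'u where "r = undefined"
  define E where "E = (\<lambda>y. if y \<in> X then {r} else {})"
  have E: "E \<in> families X"
    by (auto simp: E_def families_def)
  have u: "\<exists>!f. f \<in> Arr (Fam X) \<and> src f = E \<and> tgt f = T"
    using T E by (simp add: is_terminal_def)
  then obtain f where f: "f \<in> Arr (Fam X)" "src f = E" "tgt f = T"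
    by blast
  have uniq: "g = f" if "g \<in> Arr (Fam X)" "src g = E" "tgt g = T" for g
    by (rule ex1E[OF u]) (use f that in blast)
  have e: "act f y r \<in> T y" if "y \<in> X" for y
    using act_in[OF f(1), of r y] f that by (simp add: E_def)
  have "b = act f x r" if b: "b \<in> T x" for b
  proof -
    \<comment> \<open>The unique section, altered at the single index \<open>x\<close> to take the
      value \<open>b\<close>, is again a section, so \<open>b\<close> was its value there
      already.\<close>
    let ?g = "mk_arr E T (\<lambda>y _. if y = x then b else act f y r)"
    have "?g \<in> Arr (Fam X)"
      using b e by (intro mk_arr_in E Tf) (auto simp: E_def split: if_splits)
    then have "?g = f"
      by (rule uniq) simp_all
    from arg_cong[OF this, of "\<lambda>g. act g x r"] show ?thesis
      using x by (simp add: E_def)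
  qed
  then show ?thesis
    using e[OF x] by blast
qed

lemma ultrafilter_on_transport:
  assumes "bij_betw h S S'" and U: "ultrafilter_on S' \<U>"
  shows "ultrafilter_on S {W. W \<subseteq> S \<and> h ` W \<in> \<U>}"
proof -
  have inj: "inj_on h S" and im: "h ` S = S'"
    using assms(1) by (auto simp: bij_betw_def)
  show ?thesis
    unfolding ultrafilter_on_def
  proof (intro conjI ballI allI impI)
    show "S \<in> {W. W \<subseteq> S \<and> h ` W \<in> \<U>}" "{} \<notin> {W. W \<subseteq> S \<and> h ` W \<in> \<U>}"
      using ultrafilter_top[OF U] ultrafilter_empty[OF U] by (auto simp: im)
    show "V \<inter> W \<in> {W. W \<subseteq> S \<and> h ` W \<in> \<U>}"
      if "V \<in> {W. W \<subseteq> S \<and> h ` W \<in> \<U>}" "W \<in> {W. W \<subseteq> S \<and> h ` W \<in> \<U>}" for V W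
      using that ultrafilter_Int[OF U] inj_on_image_Int[OF inj, of V W] by auto
    show "W \<in> {W. W \<subseteq> S \<and> h ` W \<in> \<U>}"
      if "V \<in> {W. W \<subseteq> S \<and> h ` W \<in> \<U>}" "V \<subseteq> W \<and> W \<subseteq> S" for V W
      using that im ultrafilter_mono[OF U, of "h ` V" "h ` W"] by auto
    show "V \<in> {W. W \<subseteq> S \<and> h ` W \<in> \<U>} \<or> S - V \<in> {W. W \<subseteq> S \<and> h ` W \<in> \<U>}" if "V \<subseteq> S" for V
      using that im ultrafilter_cases[OF U, of "h ` V"] inj_on_image_set_diff[OF inj, of S V] by auto
  qed auto
qed

text \<open>Classes are subsets of \<open>S\<close>, so the induced map of quotients is the image
  map, and it inherits injectivity from \<open>\<Phi>\<close> on all subsets.\<close>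

lemma bij_betw_image_quotient:
  assumes \<Phi>: "bij_betw \<Phi> S S'" and r: "equiv S r" and r': "equiv S' r'"
    and iff: "\<And>s t. s \<in> S \<Longrightarrow> t \<in> S \<Longrightarrow> (\<Phi> s, \<Phi> t) \<in> r' \<longleftrightarrow> (s, t) \<in> r"
  shows "bij_betw ((`) \<Phi>) (S // r) (S' // r')"
    and "\<And>s. s \<in> S \<Longrightarrow> \<Phi> ` (r `` {s}) = r' `` {\<Phi> s}"
proof -
  have inj: "inj_on \<Phi> S" and im: "\<Phi> ` S = S'"
    using \<Phi> by (auto simp: bij_betw_def)
  have sub: "r `` {s} \<subseteq> S" "r' `` {s'} \<subseteq> S'" for s s'
    using r r' by (auto simp: equiv_def)
  show cls: "\<Phi> ` (r `` {s}) = r' `` {\<Phi> s}" if s: "s \<in> S" for s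
  proof (intro equalityI image_subsetI subsetI)
    fix t assume "t \<in> r `` {s}"
    then show "\<Phi> t \<in> r' `` {\<Phi> s}"
      using sub(1)[of s] iff[OF s, of t] by auto
  next
    fix t' assume t': "t' \<in> r' `` {\<Phi> s}"
    then obtain t where "t \<in> S" "t' = \<Phi> t"
      using sub(2)[of "\<Phi> s"] im by auto
    then show "t' \<in> \<Phi> ` (r `` {s})"
      using t' iff[OF s, of t] by auto
  qed
  show "bij_betw ((`) \<Phi>) (S // r) (S' // r')"
    unfolding bij_betw_def
  proof
    show "inj_on ((`) \<Phi>) (S // r)"
      by (rule inj_on_subset[OF inj_on_image_Pow[OF inj]]) (use sub(1) in \<open>auto elim!: quotientE\<close>)
    have "S' // r' = (\<lambda>s. r' `` {\<Phi> s}) ` S"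
      unfolding im[symmetric] by (auto simp: quotient_def)
    also have "\<dots> = (`) \<Phi> ` (S // r)"
      using cls by (auto simp: quotient_def image_iff)
    finally show "(`) \<Phi> ` (S // r) = S' // r'" ..
  qed
qed

text \<open>The projection from \<open>X.T\<close> to \<open>X\<close> is a bijection with inverse
  \<open>x \<mapsto> (x, e x)\<close>. Precomposing sections with this inverse gives
  \<open>\<Phi>\<close>, and the ultrafilter on \<open>X.T\<close> is the one on \<open>X\<close>
  carried along the same bijection.\<close>

lemma terminal_ultraproduct_isomorphic:
  fixes T :: "('x, 'u::infinite) family"
  assumes T: "is_terminal (Fam X) T" and U: "ultrafilter_on X \<U>"
  shows "FC_isomorphic (Fam X :: (('x, 'u) family, _) cat)
    (functor_comp (ultraproduct {W. W \<subseteq> Sigma X T \<and> fst ` W \<in> \<U>}) (reindex (Sigma X T) fst))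
    (ultraproduct \<U>)" (is "FC_isomorphic _ ?F _")
    and "ultrafilter_on (Sigma X T) {W. W \<subseteq> Sigma X T \<and> fst ` W \<in> \<U>}"
proof -
  let ?U = "{W. W \<subseteq> Sigma X T \<and> fst ` W \<in> \<U>}"
  let ?R = "On_obj (reindex (Sigma X T) fst) :: ('x, 'u) family \<Rightarrow> _"
  have Tf: "T \<in> families X"
    using T by (simp add: is_terminal_def)
  obtain e where e: "\<And>x. x \<in> X \<Longrightarrow> T x = {e x}"
    using terminal_singleton[OF T] by metis
  have ST: "Sigma X T = (\<lambda>x. (x, e x)) ` X"
    using e by auto
  have "bij_betw fst (Sigma X T) X"
    unfolding ST by (auto simp: bij_betw_def inj_on_def image_image)
  then show U': "ultrafilter_on (Sigma X T) ?U"
    using U by (rule ultrafilter_on_transport)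
  define \<Phi> :: "(('x \<times> 'u) \<rightharpoonup> 'u) \<Rightarrow> ('x \<rightharpoonup> 'u)" where "\<Phi> \<sigma> x = \<sigma> (x, e x)" for \<sigma> x
  \<comment> \<open>Inside \<open>X.T\<close> the image under \<open>fst\<close> is the preimage
    under \<open>x \<mapsto> (x, e x)\<close>, the form in which the domain of
    \<open>\<Phi> \<sigma>\<close> appears.\<close>
  have memU: "W \<in> ?U \<longleftrightarrow> W \<subseteq> Sigma X T \<and> {x. (x, e x) \<in> W} \<in> \<U>" for W
  proof -
    have "W \<subseteq> Sigma X T \<Longrightarrow> fst ` W = {x. (x, e x) \<in> W}"
      unfolding ST by force
    then show ?thesis
      by auto
  qed
  have dom: "dom (\<Phi> \<sigma>) = {x. (x, e x) \<in> dom \<sigma>}" for \<sigma>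
    by (auto simp: \<Phi>_def)
  have bij: "bij_betw \<Phi> (partial_sections ?U (?R Y)) (partial_sections \<U> Y)" for Y :: "('x, 'u) family"
  \<comment> \<open>The test for \<open>Sigma X T\<close> is essential:
    \<open>\<tau> (fst t)\<close> alone would also be defined at pairs whose second component is not
    in the fibre of \<open>T\<close>.\<close>
  proof (rule bij_betw_byWitness[where f' = "\<lambda>\<tau> t. if t \<in> Sigma X T then \<tau> (fst t) else None"])
    show "\<forall>\<sigma>\<in>partial_sections ?U (?R Y). (\<lambda>t. if t \<in> Sigma X T then \<Phi> \<sigma> (fst t) else None) = \<sigma>"
    proof (intro ballI ext)
      fix \<sigma> t assume "\<sigma> \<in> partial_sections ?U (?R Y)"
      then have "dom \<sigma> \<subseteq> Sigma X T"
        by (auto simp: partial_sections_iff)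
      then have "\<sigma> t = None" if "t \<notin> Sigma X T"
        using that by blast
      then show "(if t \<in> Sigma X T then \<Phi> \<sigma> (fst t) else None) = \<sigma> t"
        by (auto simp: \<Phi>_def ST)
    qed
    show "\<forall>\<tau>\<in>partial_sections \<U> Y. \<Phi> (\<lambda>t. if t \<in> Sigma X T then \<tau> (fst t) else None) = \<tau>"
    proof (intro ballI ext)
      fix \<tau> x assume "\<tau> \<in> partial_sections \<U> Y"
      then have "dom \<tau> \<subseteq> X"
        using ultrafilter_subset[OF U] by (auto simp: partial_sections_iff)
      then have "\<tau> x = None" if "x \<notin> X"
        using that by blast
      then show "\<Phi> (\<lambda>t. if t \<in> Sigma X T then \<tau> (fst t) else None) x = \<tau> x"
        by (cases "x \<in> X") (auto simp: \<Phi>_def ST)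
    qed
    show "\<Phi> ` partial_sections ?U (?R Y) \<subseteq> partial_sections \<U> Y"
    proof (rule image_subsetI)
      fix \<sigma> assume \<sigma>: "\<sigma> \<in> partial_sections ?U (?R Y)"
      then have "dom (\<Phi> \<sigma>) \<in> \<U>"
        unfolding dom partial_sections_iff memU by blast
      moreover have "y \<in> Y x" if "\<Phi> \<sigma> x = Some y" for x y
        using \<sigma> that unfolding pulled_sections_iff[OF U'] \<Phi>_def by fastforce
      ultimately show "\<Phi> \<sigma> \<in> partial_sections \<U> Y"
        by (simp add: partial_sections_iff)
    qed
    show "(\<lambda>\<tau> t. if t \<in> Sigma X T then \<tau> (fst t) else None) ` partial_sections \<U> Y \<subseteq> partial_sections ?U (?R Y)"
    proof (rule image_subsetI)
      fix \<tau> assume \<tau>: "\<tau> \<in> partial_sections \<U> Y"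
      let ?\<sigma> = "\<lambda>t. if t \<in> Sigma X T then \<tau> (fst t) else None"
      have d: "dom \<tau> \<in> \<U>" "dom \<tau> \<subseteq> X"
        using \<tau> ultrafilter_subset[OF U] by (auto simp: partial_sections_iff)
      have "{x. (x, e x) \<in> dom ?\<sigma>} = dom \<tau>"
        using d(2) by (auto simp: ST dom_def split: if_splits)
      then have "dom ?\<sigma> \<in> ?U"
        unfolding memU using d(1) by (auto split: if_splits)
      moreover have "y \<in> Y (fst t)" if "?\<sigma> t = Some y" for t y
        using \<tau> that by (auto simp: partial_sections_iff split: if_splits)
      ultimately show "?\<sigma> \<in> partial_sections ?U (?R Y)"
        unfolding pulled_sections_iff[OF U'] by blast
    qed
  qed
  have iff: "(\<Phi> \<sigma>, \<Phi> \<tau>) \<in> section_eq \<U> Y \<longleftrightarrow> (\<sigma>, \<tau>) \<in> section_eq ?U (?R Y)"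
    if \<sigma>: "\<sigma> \<in> partial_sections ?U (?R Y)" and \<tau>: "\<tau> \<in> partial_sections ?U (?R Y)"
    for \<sigma> \<tau> and Y :: "('x, 'u) family"
  proof
    assume "(\<Phi> \<sigma>, \<Phi> \<tau>) \<in> section_eq \<U> Y"
    then obtain W where W: "W \<in> \<U>" "\<And>x. x \<in> W \<Longrightarrow> \<exists>y. \<Phi> \<sigma> x = Some y \<and> \<Phi> \<tau> x = Some y"
      by (elim section_eqE) blast
    have "{x. (x, e x) \<in> (\<lambda>x. (x, e x)) ` W} = W"
      by auto
    then have W': "(\<lambda>x. (x, e x)) ` W \<in> ?U"
      unfolding memU ST using W(1) ultrafilter_subset[OF U W(1)] by (auto simp: image_image)
    show "(\<sigma>, \<tau>) \<in> section_eq ?U (?R Y)"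
      by (rule section_eqI[OF \<sigma> \<tau> W']) (use W(2) in \<open>auto simp: \<Phi>_def\<close>)
  next
    assume "(\<sigma>, \<tau>) \<in> section_eq ?U (?R Y)"
    then obtain W where W: "W \<in> ?U" "\<And>t. t \<in> W \<Longrightarrow> \<exists>y. \<sigma> t = Some y \<and> \<tau> t = Some y"
      by (elim section_eqE) blast
    have "{x. (x, e x) \<in> W} \<in> \<U>"
      using W(1) unfolding memU by blast
    then show "(\<Phi> \<sigma>, \<Phi> \<tau>) \<in> section_eq \<U> Y"
      by (rule section_eqI[OF bij_betw_apply[OF bij \<sigma>] bij_betw_apply[OF bij \<tau>]])
        (use W(2) in \<open>auto simp: \<Phi>_def\<close>)
  qed
  note Q = bij_betw_image_quotient[OF bij equiv_section_eq[OF U'] equiv_section_eq[OF U]]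
  have cls: "\<Phi> ` (section_eq ?U (?R Y) `` {\<sigma>}) = section_eq \<U> Y `` {\<Phi> \<sigma>}"
    if "\<sigma> \<in> partial_sections ?U (?R Y)" for \<sigma> and Y :: "('x, 'u) family"
    by (rule Q(2)[OF _ that]) (rule iff)
  have "natural_iso (Fam X) ?F (ultraproduct \<U>) (\<lambda>_. (`) \<Phi>)"
    unfolding natural_iso_def Fam_Obj Fam_Dom Fam_Cod
  proof (intro conjI ballI)
    fix Y :: "('x, 'u) family"
    show "bij_betw ((`) \<Phi>) (On_obj ?F Y) (On_obj (ultraproduct \<U>) Y)"
      unfolding pulled_obj[OF U'] ultraproduct_obj by (rule Q(1)) (rule iff)
  next
    fix f :: "('x, 'u) family_map" and c
    assume f: "f \<in> Arr (Fam X)" and c: "c \<in> On_obj ?F (src f)"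
    obtain \<sigma> where \<sigma>: "\<sigma> \<in> partial_sections ?U (?R (src f))" "c = section_eq ?U (?R (src f)) `` {\<sigma>}"
      using c by (rule pulled_classE[OF U'])
    have "On_arr (ultraproduct \<U>) f (section_eq \<U> (src f) `` {\<Phi> \<sigma>}) =
        section_eq \<U> (tgt f) `` {\<lambda>x. map_option (act f x) (\<Phi> \<sigma> x)}"
      using ultraproduct_arr[OF U bij_betw_apply[OF bij \<sigma>(1)], of "act f" "tgt f"] act_in[OF f]
      by (cases f) auto
    also have "(\<lambda>x. map_option (act f x) (\<Phi> \<sigma> x)) = \<Phi> (\<lambda>t. map_option (act f (fst t)) (\<sigma> t))"
      by (auto simp: \<Phi>_def)
    finally show "\<Phi> ` On_arr ?F f c = On_arr (ultraproduct \<U>) f (\<Phi> ` c)"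
      unfolding \<sigma>(2) pulled_arr[OF U' f \<sigma>(1)] cls[OF \<sigma>(1)] cls[OF pulled_post[OF U' f \<sigma>(1)]] ..
  qed
  then show "FC_isomorphic (Fam X) ?F (ultraproduct \<U>)"
    using pulled_FC_object[OF U'] natural_iso_FC_object unfolding FC_isomorphic_def by blast
qed

text \<open>Any terminal family may play the part of \<open>1\<close>, so the second claim
  quantifies over all of them. It is the first claim at \<open>T\<close>, followed by the change of
  base along the bijection of \<open>X.T\<close> with \<open>X\<close>.\<close>

theorem proposition24:
  fixes X :: "'x set"
  shows "(\<forall>(A :: ('x, 'u::infinite) family) \<U>.
            A \<in> Obj (Fam X) \<and> ultrafilter_on (Sigma X A) \<U> \<longrightarrow>
            FC_isomorphic (Fam X)
              (integral (Fam X) (representable (UF (Fam X)) (A, object_ultrafilter X A \<U>)))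
              (functor_comp (ultraproduct \<U>) (reindex (Sigma X A) fst)))
       \<and> (\<forall>(T :: ('x, 'u) family) \<U>.
            is_terminal (Fam X) T \<and> ultrafilter_on X \<U> \<longrightarrow>
            FC_isomorphic (Fam X)
              (integral (Fam X) (representable (UF (Fam X))
                 (T, object_ultrafilter X T {W. W \<subseteq> Sigma X T \<and> fst ` W \<in> \<U>})))
              (ultraproduct \<U>))"
proof (intro conjI allI impI; elim conjE)
  fix A :: "('x, 'u) family" and \<U>
  assume "A \<in> Obj (Fam X)" and U: "ultrafilter_on (Sigma X A) \<U>"
  then have A: "A \<in> families X" by simp
  show "FC_isomorphic (Fam X)
      (integral (Fam X) (representable (UF (Fam X)) (A, object_ultrafilter X A \<U>)))
      (functor_comp (ultraproduct \<U>) (reindex (Sigma X A) fst))"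
    by (rule representable_isomorphic_ultraproduct[OF A U])
next
  fix T :: "('x, 'u) family" and \<U>
  assume T: "is_terminal (Fam X) T" and U: "ultrafilter_on X \<U>"
  then have "T \<in> families X"
    by (simp add: is_terminal_def)
  then show "FC_isomorphic (Fam X)
      (integral (Fam X) (representable (UF (Fam X))
         (T, object_ultrafilter X T {W. W \<subseteq> Sigma X T \<and> fst ` W \<in> \<U>})))
      (ultraproduct \<U>)"
    by (intro FC_isomorphic_trans[OF representable_isomorphic_ultraproduct terminal_ultraproduct_isomorphic(1)[OF T U]]
        terminal_ultraproduct_isomorphic(2)[OF T U])
qed

end
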